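(* Suppose the dyadic array satisfies the sampling scheme described in the context. Let $\mathcal F$ be a pointwise measurable VC-type class of measurable real functions of a dyadic observation, with envelope $F$ satisfying $PF^2<\infty$. For $f\in\mathcal F$ let $\bar f_i=(n-1)^{-1}\sum_{j\ne i}f(Z_{ij})$. Then $$\sup_{f\in\mathcal F}\frac1n\sum_{i=1}^n\Big[\bar f_i-\mathbb P_nf-f_1(U_i)+\frac1n\sum_{j=1}^nf_1(U_j)\Big]^2=o_p(1).$$
   Context: Sampling: node variables $(U_i)_{i\ge1}$ are i.i.d., dyad variables $(U_{ij})_{i<j}$ are i.i.d., and all of these are mutually independent. For $i<j$, $Z_{ij}=(Y_{ij},X_{ij}')'=\tau(U_i,U_j,U_{ij})$ with $\tau$ measurable and symmetric in its first two arguments, $Y_{ij}$ real and $X_{ij}\in\mathcal X\subset\mathbb R^d$ a compact rectangle; $Z_{ij}=Z_{ji}$ for $j<i$. One observes $Z_{ij}$, $1\le i<j\le n$; $N_n=n(n-1)/2$; $\mathbb P_nf=N_n^{-1}\sum_{i<j}f(Z_{ij})$; $Pf=E[f(Z_{12})]$; $f_1(u)=E[f(Z_{12})\mid U_1=u]-Pf$. $\mathcal F$ is VC type with envelope $F$ if $|f|\le F$ for all $f\in\mathcal F$ and there are finite constants $A,v$ with $\sup_Q N(\epsilon\|F\|_{Q,2},\mathcal F,L_2(Q))\le (A/\epsilon)^v$ for all $0<\epsilon\le1$, the supremum being over probability measures $Q$ (with $0<\|F\|_{Q,2}<\infty$), $\|f\|_{Q,2}=(Q|f|^2)^{1/2}$,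 $N$ denoting covering numbers. $\mathcal F$ is pointwise measurable if it has a countable subclass such that each $f\in\mathcal F$ is a pointwise limit of a sequence from it. *)

theory Defs
  imports "HOL-Probability.Probability"
begin

section \<open>Dyadic arrays\<close>

definition obs_space :: "(real ^ 'd) set \<Rightarrow> (real \<times> (real ^ 'd)) measure" where
  "obs_space \<X> = restrict_space borel (UNIV \<times> \<X>)"

text \<open>
  Nodes are numbered from 1. The dyad variable of \<open>{i, j}\<close> is \<open>V i j\<close> with \<open>i < j\<close>; the values of
  \<open>V i j\<close> for other indices, and those of \<open>Z i i\<close>, are unconstrained and never used.
  Mutual independence is stated with \<open>indep_sets\<close> rather than \<open>indep_vars\<close> because node and dyad
  variables may take values in different types.
\<close>

locale dyadic_array = prob_space M
  for M :: "'w measure" and MU :: "'u measure" and MV :: "'v measure"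
    and U :: "nat \<Rightarrow> 'w \<Rightarrow> 'u" and V :: "nat \<Rightarrow> nat \<Rightarrow> 'w \<Rightarrow> 'v"
    and \<tau> :: "'u \<Rightarrow> 'u \<Rightarrow> 'v \<Rightarrow> real \<times> (real ^ 'd)" and \<X> :: "(real ^ 'd) set"
    and Z :: "nat \<Rightarrow> nat \<Rightarrow> 'w \<Rightarrow> real \<times> (real ^ 'd)" +
  assumes U_measurable: "1 \<le> i \<Longrightarrow> U i \<in> M \<rightarrow>\<^sub>M MU"
    and V_measurable: "1 \<le> i \<Longrightarrow> i < j \<Longrightarrow> V i j \<in> M \<rightarrow>\<^sub>M MV"
    and U_ident: "1 \<le> i \<Longrightarrow> distr M MU (U i) = distr M MU (U 1)"
    and V_ident: "1 \<le> i \<Longrightarrow> i < j \<Longrightarrow> distr M MV (V i j) = distr M MV (V 1 2)"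
    and UV_indep: "indep_sets
        (case_sum (\<lambda>i. {U i -` B \<inter> space M | B. B \<in> sets MU})
                  (\<lambda>(i, j). {V i j -` B \<inter> space M | B. B \<in> sets MV}))
        ({1..} <+> {(i, j). 1 \<le> i \<and> i < j})"
    and rectangle: "\<exists>a b. \<X> = cbox a b"
    and tau_measurable: "(\<lambda>(u, u', v). \<tau> u u' v) \<in> MU \<Otimes>\<^sub>M (MU \<Otimes>\<^sub>M MV) \<rightarrow>\<^sub>M obs_space \<X>"
    and tau_sym: "u \<in> space MU \<Longrightarrow> u' \<in> space MU \<Longrightarrow> v \<in> space MV \<Longrightarrow> \<tau> u u' v = \<tau> u' u v"
    and Z_eq: "1 \<le> i \<Longrightarrow> i < j \<Longrightarrow> \<omega> \<in> space M \<Longrightarrow> Z i j \<omega> = \<tau> (U i \<omega>) (U j \<omega>) (V i j \<omega>)"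
    and Z_flip: "1 \<le> j \<Longrightarrow> j < i \<Longrightarrow> \<omega> \<in> space M \<Longrightarrow> Z i j \<omega> = Z j i \<omega>"

definition pop_mean :: "'w measure \<Rightarrow> (nat \<Rightarrow> nat \<Rightarrow> 'w \<Rightarrow> 'z) \<Rightarrow> ('z \<Rightarrow> real) \<Rightarrow> real" where
  "pop_mean M Z f = (\<integral>\<omega>. f (Z 1 2 \<omega>) \<partial>M)"

definition emp_mean :: "(nat \<Rightarrow> nat \<Rightarrow> 'w \<Rightarrow> 'z) \<Rightarrow> nat \<Rightarrow> ('z \<Rightarrow> real) \<Rightarrow> 'w \<Rightarrow> real" where
  "emp_mean Z n f \<omega> =
     (\<Sum>(i, j)\<in>{(i, j). 1 \<le> i \<and> i < j \<and> j \<le> n}. f (Z i j \<omega>)) / (real n * (real n - 1) / 2)"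

definition node_mean :: "(nat \<Rightarrow> nat \<Rightarrow> 'w \<Rightarrow> 'z) \<Rightarrow> nat \<Rightarrow> ('z \<Rightarrow> real) \<Rightarrow> nat \<Rightarrow> 'w \<Rightarrow> real" where
  "node_mean Z n f i \<omega> = (\<Sum>j\<in>{1..n} - {i}. f (Z i j \<omega>)) / (real n - 1)"

text \<open>
  \<open>node_proj\<close> is \<open>f\<^sub>1(u) = E[f(Z\<^sub>1\<^sub>2) | U\<^sub>1 = u] - Pf\<close>. A conditional expectation is determined only up to a
  null set that may depend on \<open>f\<close>, and a supremum over an uncountable class would see such choices.
  We therefore use one version for all \<open>f\<close>: integration against the regular conditional
  distribution of \<open>Z\<^sub>1\<^sub>2\<close> given \<open>U\<^sub>1 = u\<close>, which is the law of \<open>\<tau>(u, U\<^sub>2, U\<^sub>1\<^sub>2)\<close>. Lemma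
  \<open>node_proj_cond_exp\<close> below shows that it is a version of the conditional expectation.
\<close>

definition node_proj ::
    "'w measure \<Rightarrow> (nat \<Rightarrow> 'w \<Rightarrow> 'u) \<Rightarrow> (nat \<Rightarrow> nat \<Rightarrow> 'w \<Rightarrow> 'v) \<Rightarrow> ('u \<Rightarrow> 'u \<Rightarrow> 'v \<Rightarrow> 'z) \<Rightarrow>
     (nat \<Rightarrow> nat \<Rightarrow> 'w \<Rightarrow> 'z) \<Rightarrow> ('z \<Rightarrow> real) \<Rightarrow> 'u \<Rightarrow> real" where
  "node_proj M U V \<tau> Z f u = (\<integral>\<omega>. f (\<tau> u (U 2 \<omega>) (V 1 2 \<omega>)) \<partial>M) - pop_mean M Z f"

context dyadic_array
begin

lemma indep_U1_U2V12:
  assumes A: "A \<in> sets MU" and C: "C \<in> sets (MU \<Otimes>\<^sub>M MV)"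
  shows "prob ((U 1 -` A \<inter> space M) \<inter> ((\<lambda>\<omega>. (U 2 \<omega>, V 1 2 \<omega>)) -` C \<inter> space M))
       = prob (U 1 -` A \<inter> space M) * prob ((\<lambda>\<omega>. (U 2 \<omega>, V 1 2 \<omega>)) -` C \<inter> space M)"
proof -
  let ?E = "case_sum (\<lambda>i. {U i -` B \<inter> space M | B. B \<in> sets MU})
                  (\<lambda>(i, j). {V i j -` B \<inter> space M | B. B \<in> sets MV})"
  define I :: "bool \<Rightarrow> (nat + nat \<times> nat) set"
    where "I b = (if b then {Inl 1} else {Inl 2, Inr (1, 2)})" for b
  let ?S = "\<lambda>b. sigma_sets (space M) (\<Union>i\<in>I b. ?E i)"
  have stU: "Int_stable {U i -` B \<inter> space M | B. B \<in> sets MU}" for i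
  proof (rule Int_stableI, clarify)
    fix B B' assume "B \<in> sets MU" "B' \<in> sets MU"
    then show "\<exists>D. U i -` B \<inter> space M \<inter> (U i -` B' \<inter> space M) = U i -` D \<inter> space M \<and> D \<in> sets MU"
      by (intro exI[of _ "B \<inter> B'"]) auto
  qed
  have stV: "Int_stable {V i j -` B \<inter> space M | B. B \<in> sets MV}" for i j
  proof (rule Int_stableI, clarify)
    fix B B' assume "B \<in> sets MV" "B' \<in> sets MV"
    then show "\<exists>D. V i j -` B \<inter> space M \<inter> (V i j -` B' \<inter> space M) = V i j -` D \<inter> space M \<and> D \<in> sets MV"
      by (intro exI[of _ "B \<inter> B'"]) auto
  qed
  have ind: "indep_sets ?S UNIV"
  proof (rule indep_sets_collect_sigma)
    show "indep_sets ?E (\<Union>j\<in>UNIV. I j)"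
      by (rule indep_sets_mono_index[OF _ UV_indep]) (auto simp: I_def split: if_splits)
    show "disjoint_family_on I UNIV"
      by (auto simp: disjoint_family_on_def I_def)
    show "Int_stable (?E i)" if "i \<in> I j" for i j
      using stU stV by (cases i) auto
  qed
  define N where "N = sigma (space M) (\<Union>i\<in>I False. ?E i)"
  have sub: "(\<Union>i\<in>I False. ?E i) \<subseteq> Pow (space M)"
    by (auto simp: I_def)
  have spN: "space N = space M" and seN: "sets N = ?S False"
    using sub by (auto simp: N_def)
  have "U 2 \<in> N \<rightarrow>\<^sub>M MU"
    using measurable_space[OF U_measurable[of 2]]
    by (intro measurableI) (auto simp: spN seN I_def intro!: sigma_sets.Basic)
  moreover have "V 1 2 \<in> N \<rightarrow>\<^sub>M MV"
    using measurable_space[OF V_measurable[of 1 2]]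
    by (intro measurableI) (auto simp: spN seN I_def intro!: sigma_sets.Basic)
  ultimately have "(\<lambda>\<omega>. (U 2 \<omega>, V 1 2 \<omega>)) \<in> N \<rightarrow>\<^sub>M MU \<Otimes>\<^sub>M MV"
    by (rule measurable_Pair)
  from measurable_sets[OF this C] have c: "(\<lambda>\<omega>. (U 2 \<omega>, V 1 2 \<omega>)) -` C \<inter> space M \<in> ?S False"
    by (simp add: spN seN)
  have a: "U 1 -` A \<inter> space M \<in> ?S True"
    using A by (auto simp: I_def intro!: sigma_sets.Basic)
  show ?thesis
    using indep_setsD[OF ind, of UNIV
        "\<lambda>b. if b then U 1 -` A \<inter> space M else (\<lambda>\<omega>. (U 2 \<omega>, V 1 2 \<omega>)) -` C \<inter> space M"] a c
    by (simp add: UNIV_bool Int_commute mult.commute)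
qed

lemma node_proj_cond_exp:
  assumes f: "f \<in> borel_measurable (obs_space \<X>)"
    and int: "integrable M (\<lambda>\<omega>. f (Z 1 2 \<omega>))"
  shows "AE \<omega> in M. real_cond_exp M (vimage_algebra (space M) (U 1) MU) (\<lambda>\<omega>. f (Z 1 2 \<omega>)) \<omega>
                      - pop_mean M Z f = node_proj M U V \<tau> Z f (U 1 \<omega>)"
proof -
  let ?F = "vimage_algebra (space M) (U 1) MU"
  let ?W = "\<lambda>\<omega>. (U 2 \<omega>, V 1 2 \<omega>)"
  define D where "D = distr M (MU \<Otimes>\<^sub>M MV) ?W"
  define D1 where "D1 = distr M MU (U 1)"
  have mU1[measurable]: "U 1 \<in> M \<rightarrow>\<^sub>M MU" using U_measurable by simp
  have mU2: "U 2 \<in> M \<rightarrow>\<^sub>M MU" using U_measurable by simp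
  have mV: "V 1 2 \<in> M \<rightarrow>\<^sub>M MV" using V_measurable by simp
  have mW[measurable]: "?W \<in> M \<rightarrow>\<^sub>M MU \<Otimes>\<^sub>M MV" using mU2 mV by (rule measurable_Pair)
  interpret D: prob_space D unfolding D_def by (rule prob_space_distr) (rule mW)
  interpret D1: prob_space D1 unfolding D1_def by (rule prob_space_distr) (rule mU1)
  interpret P: pair_sigma_finite D1 D ..
  have setsD[measurable_cong]: "sets D = sets (MU \<Otimes>\<^sub>M MV)" by (simp add: D_def)
  have setsD1[measurable_cong]: "sets D1 = sets MU" by (simp add: D1_def)
  have joint: "D1 \<Otimes>\<^sub>M D = distr M (MU \<Otimes>\<^sub>M (MU \<Otimes>\<^sub>M MV)) (\<lambda>\<omega>. (U 1 \<omega>, ?W \<omega>))"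
  proof (rule pair_measure_eqI)
    show "sigma_finite_measure D1" "sigma_finite_measure D" by unfold_locales
    show "sets (D1 \<Otimes>\<^sub>M D) = sets (distr M (MU \<Otimes>\<^sub>M (MU \<Otimes>\<^sub>M MV)) (\<lambda>\<omega>. (U 1 \<omega>, ?W \<omega>)))"
      by (simp add: setsD setsD1 cong: sets_pair_measure_cong)
    fix A B assume "A \<in> sets D1" "B \<in> sets D"
    then have A: "A \<in> sets MU" and B: "B \<in> sets (MU \<Otimes>\<^sub>M MV)" by (simp_all add: setsD setsD1)
    have eq: "(\<lambda>\<omega>. (U 1 \<omega>, ?W \<omega>)) -` (A \<times> B) \<inter> space M
        = (U 1 -` A \<inter> space M) \<inter> (?W -` B \<inter> space M)" by auto
    show "emeasure D1 A * emeasure D B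
        = emeasure (distr M (MU \<Otimes>\<^sub>M (MU \<Otimes>\<^sub>M MV)) (\<lambda>\<omega>. (U 1 \<omega>, ?W \<omega>))) (A \<times> B)"
      unfolding D1_def D_def
      by (subst (1 2 3) emeasure_distr)
         (use A B in \<open>simp_all only: eq emeasure_eq_measure indep_U1_U2V12[OF A B]
            ennreal_mult[OF measure_nonneg measure_nonneg] mU1 mW pair_measureI measurable_Pair\<close>)
  qed
  define h where "h = (\<lambda>(u, w). f (\<tau> u (fst w) (snd w)))"
  have hm[measurable]: "h \<in> borel_measurable (MU \<Otimes>\<^sub>M (MU \<Otimes>\<^sub>M MV))"
    using measurable_compose[OF tau_measurable f] by (simp add: h_def case_prod_beta')
  have hZ: "f (Z 1 2 \<omega>) = h (U 1 \<omega>, ?W \<omega>)" if "\<omega> \<in> space M" for \<omega>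
    using Z_eq[of 1 2 \<omega>] that by (simp add: h_def)
  have ph[measurable]: "(\<lambda>\<omega>. (U 1 \<omega>, ?W \<omega>)) \<in> M \<rightarrow>\<^sub>M MU \<Otimes>\<^sub>M (MU \<Otimes>\<^sub>M MV)"
    using mU1 mW by (rule measurable_Pair)
  have inth0: "integrable M (\<lambda>\<omega>. h (U 1 \<omega>, ?W \<omega>))"
    by (rule iffD1[OF Bochner_Integration.integrable_cong[OF refl hZ] int])
  then have inth: "integrable (D1 \<Otimes>\<^sub>M D) h"
    unfolding joint using ph hm by (simp add: integrable_distr_eq)
  define g where "g u = (\<integral>w. h (u, w) \<partial>D)" for u
  have gm: "g \<in> borel_measurable MU"
  proof -
    have "h \<in> borel_measurable (D1 \<Otimes>\<^sub>M D)" using inth by simp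
    then have "(\<lambda>u. \<integral>w. h (u, w) \<partial>D) \<in> borel_measurable D1"
      by (intro D.borel_measurable_lebesgue_integral) simp
    then show ?thesis
      unfolding g_def by (simp add: measurable_cong_sets[OF setsD1 refl])
  qed
  have gint: "integrable D1 g"
    unfolding g_def using P.integrable_fst'[OF inth] .
  have gpr: "g u = (\<integral>\<omega>. f (\<tau> u (U 2 \<omega>) (V 1 2 \<omega>)) \<partial>M)" if "u \<in> space MU" for u
  proof -
    have "(\<lambda>w. h (u, w)) \<in> borel_measurable (MU \<Otimes>\<^sub>M MV)" using that hm by measurable
    then show ?thesis unfolding g_def D_def by (subst integral_distr[OF mW]) (simp_all add: h_def)
  qed
  have sp: "U 1 \<in> space M \<rightarrow> space MU" using measurable_space[OF mU1] by auto
  have setsF: "sets ?F = {U 1 -` B \<inter> space M | B. B \<in> sets MU}"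
    by (rule sets_vimage_algebra2[OF sp])
  have subalg: "subalgebra M ?F"
    unfolding subalgebra_def setsF using measurable_sets[OF mU1] by auto
  interpret S: finite_measure_subalgebra M ?F by unfold_locales (rule subalg)
  have main: "AE \<omega> in M. real_cond_exp M ?F (\<lambda>\<omega>. f (Z 1 2 \<omega>)) \<omega> = g (U 1 \<omega>)"
  proof (rule S.real_cond_exp_charact)
    show "integrable M (\<lambda>\<omega>. f (Z 1 2 \<omega>))" by (rule int)
    show "integrable M (\<lambda>\<omega>. g (U 1 \<omega>))"
      using gint unfolding D1_def integrable_distr_eq[OF mU1 gm] .
    show "(\<lambda>\<omega>. g (U 1 \<omega>)) \<in> borel_measurable ?F"
      by (rule measurable_compose[OF measurable_vimage_algebra1[OF sp] gm])
    fix A assume "A \<in> sets ?F"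
    then obtain B where B: "B \<in> sets MU" and A: "A = U 1 -` B \<inter> space M"
      unfolding setsF by auto
    let ?k = "\<lambda>(u, w). indicator B u * h (u, w) :: real"
    have km: "?k \<in> borel_measurable (MU \<Otimes>\<^sub>M (MU \<Otimes>\<^sub>M MV))" using B hm by measurable
    have kint: "integrable (D1 \<Otimes>\<^sub>M D) ?k"
    proof (rule Bochner_Integration.integrable_bound[OF inth])
      show "?k \<in> borel_measurable (D1 \<Otimes>\<^sub>M D)"
        unfolding joint using km by simp
      show "AE x in D1 \<Otimes>\<^sub>M D. norm (?k x) \<le> norm (h x)"
        by (auto simp: indicator_def)
    qed
    have "(\<integral>\<omega>\<in>A. f (Z 1 2 \<omega>) \<partial>M) = (\<integral>\<omega>. ?k (U 1 \<omega>, ?W \<omega>) \<partial>M)"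
      unfolding set_lebesgue_integral_def
      by (intro Bochner_Integration.integral_cong) (auto simp: A hZ indicator_def simp del: One_nat_def)
    also have "\<dots> = (\<integral>x. ?k x \<partial>(D1 \<Otimes>\<^sub>M D))"
      unfolding joint by (rule integral_distr[OF ph km, symmetric])
    also have "\<dots> = (\<integral>u. (\<integral>w. ?k (u, w) \<partial>D) \<partial>D1)"
      using P.integral_fst'[OF kint] by simp
    also have "\<dots> = (\<integral>u. indicator B u * g u \<partial>D1)"
      by (simp add: g_def)
    also have "\<dots> = (\<integral>\<omega>. indicator B (U 1 \<omega>) * g (U 1 \<omega>) \<partial>M)"
      unfolding D1_def by (rule integral_distr[OF mU1]) (use B gm in measurable)
    also have "\<dots> = (\<integral>\<omega>\<in>A. g (U 1 \<omega>) \<partial>M)"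
      unfolding set_lebesgue_integral_def
      by (intro Bochner_Integration.integral_cong) (auto simp: A indicator_def)
    finally show "(\<integral>\<omega>\<in>A. f (Z 1 2 \<omega>) \<partial>M) = (\<integral>\<omega>\<in>A. g (U 1 \<omega>) \<partial>M)" .
  qed
  show ?thesis
    using main AE_space
    by eventually_elim (simp add: node_proj_def gpr measurable_space[OF mU1] del: One_nat_def)
qed

end


section \<open>Function classes\<close>

definition square_integrable :: "'z measure \<Rightarrow> ('z \<Rightarrow> real) \<Rightarrow> bool" where
  "square_integrable Q f \<longleftrightarrow> f \<in> borel_measurable Q \<and> integrable Q (\<lambda>z. (f z)\<^sup>2)"

text \<open>Meaningful for square-integrable functions only, hence the guards where it is used.\<close>

definition L2_norm :: "'z measure \<Rightarrow> ('z \<Rightarrow> real) \<Rightarrow> real" where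
  "L2_norm Q f = sqrt (\<integral>z. (f z)\<^sup>2 \<partial>Q)"

text \<open>
  Open balls; the centres are arbitrary elements of \<open>L\<^sub>2(Q)\<close> and need not belong to the class.
  The value is \<open>\<infinity>\<close> if there is no finite cover.
\<close>

definition covering_number :: "real \<Rightarrow> ('z \<Rightarrow> real) set \<Rightarrow> 'z measure \<Rightarrow> ennreal" where
  "covering_number r \<F> Q =
     (INF G \<in> {G. finite G \<and> (\<forall>g\<in>G. square_integrable Q g) \<and>
                  (\<forall>f\<in>\<F>. \<exists>g\<in>G. square_integrable Q (\<lambda>z. f z - g z) \<and>
                                L2_norm Q (\<lambda>z. f z - g z) < r)}.
        of_nat (card G))"

definition vc_type :: "'z measure \<Rightarrow> ('z \<Rightarrow> real) set \<Rightarrow> ('z \<Rightarrow> real) \<Rightarrow> bool" where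
  "vc_type S \<F> F \<longleftrightarrow>
     F \<in> borel_measurable S \<and>
     (\<forall>f\<in>\<F>. \<forall>z\<in>space S. \<bar>f z\<bar> \<le> F z) \<and>
     (\<exists>A>0. \<exists>v. \<forall>\<epsilon>. 0 < \<epsilon> \<and> \<epsilon> \<le> 1 \<longrightarrow>
        (SUP Q \<in> {Q. prob_space Q \<and> sets Q = sets S \<and> square_integrable Q F \<and> 0 < L2_norm Q F}.
           covering_number (\<epsilon> * L2_norm Q F) \<F> Q) \<le> ennreal ((A / \<epsilon>) powr v))"

definition pointwise_measurable :: "'z measure \<Rightarrow> ('z \<Rightarrow> real) set \<Rightarrow> bool" where
  "pointwise_measurable S \<F> \<longleftrightarrow>
     (\<exists>\<G>\<subseteq>\<F>. countable \<G> \<and>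
        (\<forall>f\<in>\<F>. \<exists>g. (\<forall>m. g m \<in> \<G>) \<and> (\<forall>z\<in>space S. (\<lambda>m. g m z) \<longlonglongrightarrow> f z)))"


section \<open>Stochastic order\<close>

text \<open>
  \<open>X\<^sub>n = o\<^sub>p(1)\<close> for nonnegative \<open>X\<^sub>n\<close>. Outer probability is used because a supremum over an uncountable
  class is a priori measurable only up to a null set, whereas \<open>measure\<close> and \<open>emeasure\<close> are 0 on
  nonmeasurable sets; on measurable events it is the probability itself.
\<close>

definition o_p_1 :: "'w measure \<Rightarrow> (nat \<Rightarrow> 'w \<Rightarrow> ennreal) \<Rightarrow> bool" where
  "o_p_1 M X \<longleftrightarrow>
     (\<forall>\<epsilon>>0. (\<lambda>n. outer_measure_of M {\<omega> \<in> space M. X n \<omega> > ennreal \<epsilon>}) \<longlonglongrightarrow> 0)"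

end

theory Submission
  imports Defs
begin

text \<open>
  Put \<open>g\<^sub>f(u) = E[f(Z\<^sub>1\<^sub>2) | U\<^sub>1 = u]\<close>. The summand is \<open>a\<^sub>i\<close> minus the average of the \<open>a\<^sub>j\<close>, where \<open>a\<^sub>i\<close> is the
  node mean minus \<open>g\<^sub>f(U\<^sub>i)\<close>; hence the statistic is at most the average of the \<open>a\<^sub>i\<^sup>2\<close>, and, the
  supremum of an average being at most the average of the suprema, it suffices that
  \<open>E sup\<^sub>f a\<^sub>1\<^sup>2\<close> tends to 0. Given \<open>U\<^sub>1 = u\<close> the pairs \<open>(U\<^sub>j, V\<^sub>1\<^sub>j)\<close> are i.i.d., so this is a law of large
  numbers for an i.i.d. sample. After symmetrization with a ghost sample and random signs, the
  uniform entropy bound supplies \<open>N\<close> functions covering the class in the \<open>L\<^sub>2\<close> norm of the sample at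
  relative radius \<open>\<delta>\<close>. Bounding the maximum over the cover by the sum of the second moments gives
  \<open>E sup\<^sub>f a\<^sub>1\<^sup>2 \<le> (8\<delta>\<^sup>2 + 32N/(n - 1)) PF\<^sup>2\<close>, with no chaining or sub-Gaussian bound.
\<close>

section \<open>Random signs\<close>

text \<open>So crude a bound over the cover is affordable because \<open>N\<close> depends on
  \<delta> alone: uniformity over all laws \<open>Q\<close> makes one \<open>N\<close> serve every
  sample, every sample size and every value of \<open>U i\<close>. With \<delta> fixed, the limit in
  n removes the term with \<open>N\<close>, and \<delta> is made small independently of n; only
  second moments of \<open>F\<close> enter. The obstacle is measurability. The supremum over the
  class need not be measurable, and its centring \<open>cond_mean f\<close> is an integral that
  takes the default value 0 where it does not exist. All moment bounds are therefore proved for the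
  countable subclass given by pointwise measurability. Dominated convergence carries them to the
  whole class off one null set chosen from \<open>F\<close> alone. Constants: comparison with a
  centre costs a factor 2, and a relevant centre has at most 4 times the squared norm of the
  envelope, which gives \<open>2 * \<delta>\<^sup>2\<close> and 8. Splitting off the ghost sample
  costs 2 and its own moment another 2, whence 8 and 32.\<close>

lemma sum_signs_square:
  fixes g :: "'i \<Rightarrow> real"
  assumes "finite J"
  shows "(\<Sum>S\<in>Pow J. (\<Sum>j\<in>J. if j \<in> S then - g j else g j)\<^sup>2) = 2 ^ card J * (\<Sum>j\<in>J. (g j)\<^sup>2)"
  using assms
proof (induction J)
  case (insert a J)
  let ?s = "\<lambda>S. \<Sum>j\<in>J. if j \<in> S then - g j else g j"
  have inj: "inj_on (insert a) (Pow J)"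
    using insert.hyps by (auto simp: inj_on_def)
  have disj: "Pow J \<inter> insert a ` Pow J = {}"
    using insert.hyps by auto
  have 1: "(\<Sum>j\<in>insert a J. if j \<in> S then - g j else g j) = g a + ?s S" if "S \<in> Pow J" for S
    using insert.hyps that by auto
  have 2: "(\<Sum>j\<in>insert a J. if j \<in> insert a S then - g j else g j) = - g a + ?s S" if "S \<in> Pow J" for S
    using insert.hyps that by (auto intro!: sum.cong)
  have "(\<Sum>S\<in>Pow (insert a J). (\<Sum>j\<in>insert a J. if j \<in> S then - g j else g j)\<^sup>2)
      = (\<Sum>S\<in>Pow J. (g a + ?s S)\<^sup>2) + (\<Sum>S\<in>Pow J. (- g a + ?s S)\<^sup>2)"
  proof -
    have "(\<Sum>S\<in>insert a ` Pow J. (\<Sum>j\<in>insert a J. if j \<in> S then - g j else g j)\<^sup>2)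
        = (\<Sum>S\<in>Pow J. (\<Sum>j\<in>insert a J. if j \<in> insert a S then - g j else g j)\<^sup>2)"
      by (simp only: sum.reindex[OF inj] o_def)
    also have "\<dots> = (\<Sum>S\<in>Pow J. (- g a + ?s S)\<^sup>2)"
      by (rule sum.cong[OF refl]) (simp only: 2)
    finally show ?thesis
      unfolding Pow_insert using insert.hyps disj
      by (subst sum.union_disjoint) (simp_all add: 1 del: sum.insert)
  qed
  \<comment> \<open>The cross terms \<open>g a * ?s S\<close> have opposite signs for
    \<open>S\<close> and \<open>insert a S\<close> and cancel. This is the orthogonality of random
    signs, with \<open>S\<close> the set of indices whose sign is negative.\<close>
  also have "\<dots> = (\<Sum>S\<in>Pow J. 2 * (g a)\<^sup>2 + 2 * (?s S)\<^sup>2)"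
    unfolding sum.distrib[symmetric] by (rule sum.cong) (auto simp: power2_eq_square algebra_simps)
  also have "\<dots> = 2 ^ card (insert a J) * (\<Sum>j\<in>insert a J. (g j)\<^sup>2)"
    using insert by (simp add: sum.distrib sum_distrib_left[symmetric] card_Pow algebra_simps)
  finally show ?case .
qed simp

lemma sum_square_le:
  fixes a :: "'i \<Rightarrow> real"
  shows "(\<Sum>j\<in>J. a j)\<^sup>2 \<le> real (card J) * (\<Sum>j\<in>J. (a j)\<^sup>2)"
proof -
  have "(\<Sum>j\<in>J. 1 * a j)\<^sup>2 \<le> (\<Sum>j\<in>J. 1\<^sup>2) * (\<Sum>j\<in>J. (a j)\<^sup>2)"
    by (rule Cauchy_Schwarz_ineq_sum)
  then show ?thesis by simp
qed

text \<open>Replacing \<open>h\<close> by a nearby centre costs at most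
  \<open>card J * \<delta>\<^sup>2\<close> times the squared envelope norm for every choice of
  signs, by Cauchy-Schwarz, while the squared signed sums of the centres are summed over all signs
  exactly by \<open>sum_signs_square\<close>. Summing over \<open>Pow J\<close> instead of averaging
  keeps division out of \<open>ennreal\<close>.\<close>

lemma sum_signs_SUP_le:
  fixes H :: "('i \<Rightarrow> real) set" and e :: "'i \<Rightarrow> real"
  assumes J: "finite J"
    and env: "\<And>h j. h \<in> H \<Longrightarrow> j \<in> J \<Longrightarrow> \<bar>h j\<bar> \<le> e j"
    and G: "finite G" "card G \<le> N"
    and cover: "\<And>h. h \<in> H \<Longrightarrow> \<exists>g\<in>G. (\<Sum>j\<in>J. (h j - g j)\<^sup>2) \<le> \<delta>\<^sup>2 * (\<Sum>j\<in>J. (e j)\<^sup>2)"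
    and \<delta>: "0 \<le> \<delta>" "\<delta> \<le> 1"
  shows "(\<Sum>S\<in>Pow J. SUP h\<in>H. ennreal ((\<Sum>j\<in>J. if j \<in> S then - h j else h j)\<^sup>2))
    \<le> ennreal (2 ^ card J * ((2 * real (card J) * \<delta>\<^sup>2 + 8 * real N) * (\<Sum>j\<in>J. (e j)\<^sup>2)))"
proof -
  define m where "m = real (card J)"
  define B where "B = (\<Sum>j\<in>J. (e j)\<^sup>2)"
  \<comment> \<open>Centres need not lie under the envelope, so their own norms are uncontrolled.
    Only those close to some \<open>h\<close> matter, and for them the squared norm is at most
    \<open>2 * B + 2 * (\<delta>\<^sup>2 * B)\<close>, hence at most \<open>4 * B\<close> since
    \<delta> \<le> 1.\<close>
  define G' where "G' = {g \<in> G. (\<Sum>j\<in>J. (g j)\<^sup>2) \<le> 4 * B}"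
  let ?s = "\<lambda>S h. \<Sum>j\<in>J. if j \<in> S then - h j else h j :: real"
  have B0: "0 \<le> B" unfolding B_def by (simp add: sum_nonneg)
  have fG': "finite G'" using G by (simp add: G'_def)
  have cG': "card G' \<le> N" using G card_mono[of G G'] by (simp add: G'_def) 
  have sup: "(SUP h\<in>H. ennreal ((?s S h)\<^sup>2)) \<le> ennreal (2 * m * \<delta>\<^sup>2 * B + 2 * (\<Sum>g\<in>G'. (?s S g)\<^sup>2))" for S
  proof (rule SUP_least, rule ennreal_leI)
    fix h assume h: "h \<in> H"
    obtain g where g: "g \<in> G" "(\<Sum>j\<in>J. (h j - g j)\<^sup>2) \<le> \<delta>\<^sup>2 * B"
      using cover[OF h] by (auto simp: B_def)
    have "(\<Sum>j\<in>J. (g j)\<^sup>2) \<le> (\<Sum>j\<in>J. 2 * (e j)\<^sup>2 + 2 * (h j - g j)\<^sup>2)"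
    proof (rule sum_mono)
      fix j assume "j \<in> J"
      then have "(h j)\<^sup>2 \<le> (e j)\<^sup>2" using env[OF h] by (metis abs_ge_zero power2_abs power_mono)
      moreover have "(g j)\<^sup>2 \<le> 2 * (h j)\<^sup>2 + 2 * (h j - g j)\<^sup>2"
        using zero_le_power2[of "2 * h j - g j"] by (simp add: power2_eq_square algebra_simps)
      ultimately show "(g j)\<^sup>2 \<le> 2 * (e j)\<^sup>2 + 2 * (h j - g j)\<^sup>2" by linarith
    qed
    also have "\<dots> \<le> 2 * B + 2 * (\<delta>\<^sup>2 * B)"
      using g by (simp add: sum.distrib sum_distrib_left[symmetric] B_def)
    also have "\<dots> \<le> 4 * B"
    proof -
      have "\<delta>\<^sup>2 * B \<le> 1 * B" using \<delta> B0 by (intro mult_right_mono) (simp_all add: power_le_one)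
      then show ?thesis by simp
    qed
    finally have gG': "g \<in> G'" using g by (simp add: G'_def)
    have "(?s S h - ?s S g)\<^sup>2 = (\<Sum>j\<in>J. if j \<in> S then - (h j - g j) else h j - g j)\<^sup>2"
      unfolding sum_subtractf[symmetric] by (intro arg_cong[where f="\<lambda>x. x\<^sup>2"] sum.cong) auto
    also have "\<dots> \<le> m * (\<Sum>j\<in>J. (if j \<in> S then - (h j - g j) else h j - g j)\<^sup>2)"
      unfolding m_def by (rule sum_square_le)
    also have "(\<Sum>j\<in>J. (if j \<in> S then - (h j - g j) else h j - g j)\<^sup>2) = (\<Sum>j\<in>J. (h j - g j)\<^sup>2)"
      by (rule sum.cong) (auto simp: power2_commute)
    also have "m * \<dots> \<le> m * (\<delta>\<^sup>2 * B)"
      using g by (intro mult_left_mono) (simp_all add: m_def)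
    finally have d: "(?s S h - ?s S g)\<^sup>2 \<le> m * (\<delta>\<^sup>2 * B)" .
    have "(?s S g)\<^sup>2 \<le> (\<Sum>g\<in>G'. (?s S g)\<^sup>2)"
      using gG' fG' by (intro member_le_sum) auto
    moreover have "(?s S h)\<^sup>2 \<le> 2 * (?s S h - ?s S g)\<^sup>2 + 2 * (?s S g)\<^sup>2"
      using zero_le_power2[of "?s S h - 2 * ?s S g"] by (simp add: power2_eq_square algebra_simps)
    ultimately show "(?s S h)\<^sup>2 \<le> 2 * m * \<delta>\<^sup>2 * B + 2 * (\<Sum>g\<in>G'. (?s S g)\<^sup>2)"
      using d by simp
  qed
  have "(\<Sum>S\<in>Pow J. SUP h\<in>H. ennreal ((?s S h)\<^sup>2))
      \<le> (\<Sum>S\<in>Pow J. ennreal (2 * m * \<delta>\<^sup>2 * B + 2 * (\<Sum>g\<in>G'. (?s S g)\<^sup>2)))"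
    by (rule sum_mono) (rule sup)
  also have "\<dots> = ennreal (\<Sum>S\<in>Pow J. 2 * m * \<delta>\<^sup>2 * B + 2 * (\<Sum>g\<in>G'. (?s S g)\<^sup>2))"
    using B0 by (intro sum_ennreal) (auto simp: m_def intro!: add_nonneg_nonneg mult_nonneg_nonneg sum_nonneg)
  also have "(\<Sum>S\<in>Pow J. 2 * m * \<delta>\<^sup>2 * B + 2 * (\<Sum>g\<in>G'. (?s S g)\<^sup>2))
      = 2 ^ card J * (2 * m * \<delta>\<^sup>2 * B) + 2 * (\<Sum>g\<in>G'. \<Sum>S\<in>Pow J. (?s S g)\<^sup>2)"
    using J by (simp add: sum.distrib card_Pow sum_distrib_left[symmetric] sum.swap[of _ G'])
  also have "(\<Sum>g\<in>G'. \<Sum>S\<in>Pow J. (?s S g)\<^sup>2) = (\<Sum>g\<in>G'. 2 ^ card J * (\<Sum>j\<in>J. (g j)\<^sup>2))"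
    by (simp add: sum_signs_square[OF J])
  also have "\<dots> \<le> (\<Sum>g\<in>G'. 2 ^ card J * (4 * B))"
    by (rule sum_mono) (simp add: G'_def)
  also have "\<dots> = real (card G') * (2 ^ card J * (4 * B))" by simp
  also have "\<dots> \<le> real N * (2 ^ card J * (4 * B))"
    using cG' B0 by (intro mult_right_mono) auto
  finally show ?thesis
    by (simp add: m_def B_def algebra_simps ennreal_leI)
qed

lemma (in prob_space) square_expectation_le:
  fixes X :: "'a \<Rightarrow> real"
  assumes "integrable M X" "integrable M (\<lambda>x. (X x)\<^sup>2)"
  shows "(expectation X)\<^sup>2 \<le> expectation (\<lambda>x. (X x)\<^sup>2)"
  using variance_eq[OF assms] variance_positive[of X] by simp

section \<open>Symmetrization\<close>

lemma (in prob_space)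
  assumes "i \<in> K" and f: "f \<in> borel_measurable M"
  shows nn_integral_PiM_component: "(\<integral>\<^sup>+x. f (x i) \<partial>PiM K (\<lambda>_. M)) = (\<integral>\<^sup>+x. f x \<partial>M)"
proof -
  have "(\<integral>\<^sup>+x. f x \<partial>M) = (\<integral>\<^sup>+x. f x \<partial>distr (PiM K (\<lambda>_. M)) M (\<lambda>x. x i))"
    by (subst distr_PiM_component[OF _ \<open>i \<in> K\<close>]) (auto intro: prob_space_axioms)
  also have "\<dots> = (\<integral>\<^sup>+x. f (x i) \<partial>PiM K (\<lambda>_. M))"
    using assms by (intro nn_integral_distr) auto
  finally show ?thesis ..
qed

lemma (in prob_space)
  fixes f :: "'a \<Rightarrow> real"
  assumes "i \<in> K" and f: "integrable M f"
  shows integrable_PiM_component: "integrable (PiM K (\<lambda>_. M)) (\<lambda>x. f (x i))"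
    and integral_PiM_component: "(\<integral>x. f (x i) \<partial>PiM K (\<lambda>_. M)) = expectation f"
proof -
  have d: "distr (PiM K (\<lambda>_. M)) M (\<lambda>x. x i) = M"
    by (rule distr_PiM_component[OF _ \<open>i \<in> K\<close>]) (auto intro: prob_space_axioms)
  have m: "(\<lambda>x. x i) \<in> PiM K (\<lambda>_. M) \<rightarrow>\<^sub>M M" using assms by auto
  have fm: "f \<in> borel_measurable M" using f by auto
  show "integrable (PiM K (\<lambda>_. M)) (\<lambda>x. f (x i))"
    using integrable_distr_eq[OF m fm] f by (simp add: d)
  show "(\<integral>x. f (x i) \<partial>PiM K (\<lambda>_. M)) = expectation f"
    using integral_distr[OF m fm] by (simp add: d)
qed

lemma (in prob_space) integrable_of_square:
  fixes f :: "'a \<Rightarrow> real"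
  assumes [measurable]: "f \<in> borel_measurable M" and "integrable M (\<lambda>x. (f x)\<^sup>2)"
  shows "integrable M f"
proof (rule Bochner_Integration.integrable_bound)
  show "integrable M (\<lambda>x. 1 + (f x)\<^sup>2)" using assms by auto
  have "\<bar>y\<bar> \<le> 1 + y\<^sup>2" for y :: real
    using zero_le_power2[of "\<bar>y\<bar> - 1"] by (simp add: power2_eq_square algebra_simps abs_if split: if_splits)
  then show "AE x in M. norm (f x) \<le> norm (1 + (f x)\<^sup>2)" by auto
qed simp

lemma square_diff_le:
  fixes a b :: real shows "(a - b)\<^sup>2 \<le> 2 * a\<^sup>2 + 2 * b\<^sup>2"
  using zero_le_power2[of "a + b"] by (simp add: power2_eq_square algebra_simps)

context prob_space
begin

text \<open>Since \<open>J\<close> lies below \<open>k\<close>, shifting by \<open>k\<close> gives a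
  disjoint set of indices for the ghost sample. The cover may vary with the sample, and its members
  are just vectors of values on \<open>J\<close>, so they need not depend measurably on the sample;
  what must be uniform is the bound \<open>N\<close>.\<close>

context
  fixes H :: "('a \<Rightarrow> real) set" and e :: "'a \<Rightarrow> real" and J :: "nat set" and N k :: nat and \<delta> :: real
  assumes J: "finite J" "J \<subseteq> {..<k}" and H: "countable H"
    and meas: "\<And>h. h \<in> H \<Longrightarrow> h \<in> borel_measurable M"
    and e[measurable]: "e \<in> borel_measurable M" and int: "integrable M (\<lambda>x. (e x)\<^sup>2)"
    and env: "\<And>h x. h \<in> H \<Longrightarrow> x \<in> space M \<Longrightarrow> \<bar>h x\<bar> \<le> e x"
    and cover: "\<And>x. x \<in> J \<rightarrow> space M \<Longrightarrow> \<exists>G::(nat \<Rightarrow> real) set. finite G \<and> card G \<le> N \<and>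
      (\<forall>h\<in>H. \<exists>g\<in>G. (\<Sum>j\<in>J. (h (x j) - g j)\<^sup>2) \<le> \<delta>\<^sup>2 * (\<Sum>j\<in>J. (e (x j))\<^sup>2))"
    and \<delta>: "0 \<le> \<delta>" "\<delta> \<le> 1"
begin

text \<open>The ghost copy of observation \<open>j\<close> sits at index \<open>j + k\<close>.\<close>

abbreviation (input) "shifted \<equiv> (\<lambda>j. j + k) ` J"
abbreviation (input) "doubled \<equiv> PiM (J \<union> shifted) (\<lambda>_. M)"
abbreviation (input) "signed S j t \<equiv> (if j \<in> S then - t else t :: real)"

lemma square_integrable_H:
  assumes "h \<in> H" shows "integrable M (\<lambda>x. (h x)\<^sup>2)"
  using int
proof (rule Bochner_Integration.integrable_bound)
  show "(\<lambda>x. (h x)\<^sup>2) \<in> borel_measurable M" using meas[OF assms] by auto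
  show "AE x in M. norm ((h x)\<^sup>2) \<le> norm ((e x)\<^sup>2)"
    using env[OF assms] by (auto intro!: AE_I2) (metis abs_ge_zero power2_abs power_mono)
qed

lemma measurable_H_component:
  assumes "h \<in> H" "i \<in> K"
  shows "(\<lambda>z. h (z i)) \<in> borel_measurable (PiM K (\<lambda>_. M))"
  using assms(2) by (rule measurable_PiM_component_rev) (rule meas[OF assms(1)])

text \<open>For fixed \<open>x\<close> and \<open>h\<close>, averaging over the ghost sample turns
  \<open>h (y (j + k))\<close> into \<open>expectation h\<close>, so the centred sum is the mean of
  the difference and Jensen's inequality applies. Taking the supremum inside the integral afterwards
  only increases it.\<close>

lemma centered_le_ghost:
  assumes x: "x \<in> space (PiM J (\<lambda>_. M))"
  shows "(SUP h\<in>H. ennreal ((\<Sum>j\<in>J. h (x j) - expectation h)\<^sup>2))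
    \<le> (\<integral>\<^sup>+y. (SUP h\<in>H. ennreal ((\<Sum>j\<in>J. h (x j) - h (y (j + k)))\<^sup>2)) \<partial>PiM shifted (\<lambda>_. M))"
proof (rule SUP_least)
  fix h assume h: "h \<in> H"
  let ?P = "PiM shifted (\<lambda>_. M)" and ?X = "\<lambda>y. \<Sum>j\<in>J. h (x j) - h (y (j + k))"
  interpret P: prob_space ?P by (rule prob_space_PiM) (rule prob_space_axioms)
  have hm[measurable]: "h \<in> borel_measurable M" by (rule meas[OF h])
  have hi: "integrable M h" by (rule integrable_of_square[OF hm square_integrable_H[OF h]])
  have iX: "integrable ?P ?X"
    by (intro Bochner_Integration.integrable_sum Bochner_Integration.integrable_diff
        integrable_PiM_component hi) auto
  have "integrable ?P (\<lambda>y. real (card J) * (\<Sum>j\<in>J. 2 * (h (x j))\<^sup>2 + 2 * (h (y (j + k)))\<^sup>2))"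
    by (intro integrable_mult_right Bochner_Integration.integrable_sum Bochner_Integration.integrable_add
        integrable_PiM_component[OF _ square_integrable_H[OF h]]) auto
  then have iX2: "integrable ?P (\<lambda>y. (?X y)\<^sup>2)"
  proof (rule Bochner_Integration.integrable_bound)
    show "AE y in ?P. norm ((?X y)\<^sup>2)
      \<le> norm (real (card J) * (\<Sum>j\<in>J. 2 * (h (x j))\<^sup>2 + 2 * (h (y (j + k)))\<^sup>2))"
    proof (rule AE_I2)
      fix y
      have "(?X y)\<^sup>2 \<le> real (card J) * (\<Sum>j\<in>J. (h (x j) - h (y (j + k)))\<^sup>2)"
        by (rule sum_square_le)
      also have "\<dots> \<le> real (card J) * (\<Sum>j\<in>J. 2 * (h (x j))\<^sup>2 + 2 * (h (y (j + k)))\<^sup>2)"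
        by (intro mult_left_mono sum_mono square_diff_le) simp
      finally show "norm ((?X y)\<^sup>2)
        \<le> norm (real (card J) * (\<Sum>j\<in>J. 2 * (h (x j))\<^sup>2 + 2 * (h (y (j + k)))\<^sup>2))" by simp
    qed
  qed (use iX in measurable)
  have "P.expectation ?X = (\<Sum>j\<in>J. h (x j) - expectation h)"
  proof -
    have "P.expectation ?X = (\<Sum>j\<in>J. \<integral>y. h (x j) - h (y (j + k)) \<partial>?P)"
      by (intro Bochner_Integration.integral_sum Bochner_Integration.integrable_diff
          integrable_PiM_component hi) auto
    also have "\<dots> = (\<Sum>j\<in>J. h (x j) - expectation h)"
    proof (rule sum.cong[OF refl])
      fix j assume "j \<in> J"
      then have i: "j + k \<in> shifted" by auto
      have "(\<integral>y. h (x j) - h (y (j + k)) \<partial>?P) = (\<integral>y. h (x j) \<partial>?P) - (\<integral>y. h (y (j + k)) \<partial>?P)"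
        by (intro Bochner_Integration.integral_diff integrable_PiM_component[OF i hi]) auto
      then show "(\<integral>y. h (x j) - h (y (j + k)) \<partial>?P) = h (x j) - expectation h"
        by (simp add: integral_PiM_component[OF i hi] P.prob_space)
    qed
    finally show ?thesis .
  qed
  then have "ennreal ((\<Sum>j\<in>J. h (x j) - expectation h)\<^sup>2) \<le> ennreal (P.expectation (\<lambda>y. (?X y)\<^sup>2))"
    using P.square_expectation_le[OF iX iX2] by (auto intro: ennreal_leI)
  also have "\<dots> = (\<integral>\<^sup>+y. ennreal ((?X y)\<^sup>2) \<partial>?P)"
    by (rule nn_integral_eq_integral[symmetric, OF iX2]) simp
  also have "\<dots> \<le> (\<integral>\<^sup>+y. (SUP h\<in>H. ennreal ((\<Sum>j\<in>J. h (x j) - h (y (j + k)))\<^sup>2)) \<partial>?P)"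
    by (intro nn_integral_mono) (rule SUP_upper2[OF h order_refl])
  finally show "ennreal ((\<Sum>j\<in>J. h (x j) - expectation h)\<^sup>2)
    \<le> (\<integral>\<^sup>+y. (SUP h\<in>H. ennreal ((\<Sum>j\<in>J. h (x j) - h (y (j + k)))\<^sup>2)) \<partial>?P)" .
qed

text \<open>Exchanging an observation with its ghost leaves the product law unchanged and flips the
  sign of their difference; \<open>S\<close> is the set of indices at which the exchange is
  made.\<close>

lemma ghost_sign_invariant:
  assumes S: "S \<subseteq> J"
  shows "(\<integral>\<^sup>+z. (SUP h\<in>H. ennreal ((\<Sum>j\<in>J. h (z j) - h (z (j + k)))\<^sup>2)) \<partial>doubled)
    = (\<integral>\<^sup>+z. (SUP h\<in>H. ennreal ((\<Sum>j\<in>J. signed S j (h (z j) - h (z (j + k))))\<^sup>2)) \<partial>doubled)"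
proof -
  \<comment> \<open>\<open>t\<close> swaps \<open>j\<close> and \<open>j + k\<close> for
    \<open>j\<close> in \<open>S\<close> and fixes every other index. Elements of \<open>S\<close>
    lie below \<open>k\<close>, so the two cases cannot overlap, and \<open>t\<close> is an
    involution, hence injective.\<close>
  define t where "t i = (if i \<in> S then i + k else if k \<le> i \<and> i - k \<in> S then i - k else i)" for i
  let ?K = "J \<union> shifted"
  have Sk: "i < k" if "i \<in> S" for i using that S J by auto
  have tK: "t \<in> ?K \<rightarrow> ?K" using S by (auto simp: t_def dest: Sk)
  have ti: "t (t i) = i" for i using S by (auto simp: t_def dest: Sk)
  have inj: "inj_on t ?K" by (rule inj_on_inverseI[of _ t]) (rule ti)
  have d: "distr doubled doubled (\<lambda>z. \<lambda>i\<in>?K. z (t i)) = doubled"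
    using distr_PiM_reindex[of ?K "\<lambda>_. M" t ?K] inj tK prob_space_axioms by simp
  have m: "(\<lambda>z. \<lambda>i\<in>?K. z (t i)) \<in> doubled \<rightarrow>\<^sub>M doubled"
    using tK by (intro measurable_restrict measurable_component_singleton) auto
  have "(\<integral>\<^sup>+z. (SUP h\<in>H. ennreal ((\<Sum>j\<in>J. h (z j) - h (z (j + k)))\<^sup>2)) \<partial>doubled)
      = (\<integral>\<^sup>+z. (SUP h\<in>H. ennreal ((\<Sum>j\<in>J. h (z j) - h (z (j + k)))\<^sup>2)) \<partial>distr doubled doubled (\<lambda>z. \<lambda>i\<in>?K. z (t i)))"
    by (simp only: d)
  also have "\<dots> = (\<integral>\<^sup>+z. (SUP h\<in>H. ennreal ((\<Sum>j\<in>J. h (z (t j)) - h (z (t (j + k))))\<^sup>2)) \<partial>doubled)"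
  proof -
    let ?T = "\<lambda>z. \<lambda>i\<in>?K. z (t i)"
    have mm: "(\<lambda>z. SUP h\<in>H. ennreal ((\<Sum>j\<in>J. h (z j) - h (z (j + k)))\<^sup>2)) \<in> borel_measurable doubled"
      using H by (intro borel_measurable_SUP measurable_compose[OF _ measurable_ennreal]
         borel_measurable_power borel_measurable_sum borel_measurable_diff
         measurable_H_component) auto
    have "(\<integral>\<^sup>+z. (SUP h\<in>H. ennreal ((\<Sum>j\<in>J. h (z j) - h (z (j + k)))\<^sup>2)) \<partial>distr doubled doubled ?T)
      = (\<integral>\<^sup>+z. (SUP h\<in>H. ennreal ((\<Sum>j\<in>J. h (?T z j) - h (?T z (j + k)))\<^sup>2)) \<partial>doubled)"
      by (subst nn_integral_distr[OF m]) (simp_all only: measurable_distr_eq1 mm)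
    then show ?thesis by (simp cong: sum.cong)
  qed
  also have "\<dots> = (\<integral>\<^sup>+z. (SUP h\<in>H. ennreal ((\<Sum>j\<in>J. signed S j (h (z j) - h (z (j + k))))\<^sup>2)) \<partial>doubled)"
  proof -
    have "h (z (t j)) - h (z (t (j + k))) = signed S j (h (z j) - h (z (j + k)))"
      if "j \<in> J" for j and h :: "'a \<Rightarrow> real" and z
      using that S J by (auto simp: t_def)
    then show ?thesis by (simp cong: sum.cong)
  qed
  finally show ?thesis .
qed

lemma sum_signs_sample_le:
  assumes x: "x \<in> J \<rightarrow> space M"
  shows "(\<Sum>S\<in>Pow J. SUP h\<in>H. ennreal ((\<Sum>j\<in>J. signed S j (h (x j)))\<^sup>2))
    \<le> ennreal (2 ^ card J * ((2 * real (card J) * \<delta>\<^sup>2 + 8 * real N) * (\<Sum>j\<in>J. (e (x j))\<^sup>2)))"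
proof -
  obtain G :: "(nat \<Rightarrow> real) set" where G: "finite G" "card G \<le> N"
    "\<forall>h\<in>H. \<exists>g\<in>G. (\<Sum>j\<in>J. (h (x j) - g j)\<^sup>2) \<le> \<delta>\<^sup>2 * (\<Sum>j\<in>J. (e (x j))\<^sup>2)"
    using cover[OF x] by blast
  have "(\<Sum>S\<in>Pow J. SUP h\<in>(\<lambda>h j. h (x j)) ` H. ennreal ((\<Sum>j\<in>J. signed S j (h j))\<^sup>2))
    \<le> ennreal (2 ^ card J * ((2 * real (card J) * \<delta>\<^sup>2 + 8 * real N) * (\<Sum>j\<in>J. (e (x j))\<^sup>2)))"
    by (rule sum_signs_SUP_le[OF J(1) _ G(1,2) _ \<delta>]) (use G(3) env x in auto)
  then show ?thesis by (simp add: image_image)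
qed

text \<open>By invariance, \<open>2 ^ card J\<close> copies of the ghost integral become the sum
  over all sign sets, which the cover bounds for each fixed doubled sample. In the factor 4, one 2
  comes from separating sample and ghost inside the square, the other from integrating the envelope
  over both.\<close>

lemma nn_integral_SUP_centered_sum_le:
  "(\<integral>\<^sup>+x. (SUP h\<in>H. ennreal ((\<Sum>j\<in>J. h (x j) - expectation h)\<^sup>2)) \<partial>PiM J (\<lambda>_. M))
    \<le> ennreal (4 * (2 * real (card J) * \<delta>\<^sup>2 + 8 * real N) * real (card J) * expectation (\<lambda>x. (e x)\<^sup>2))"
proof -
  define C where "C = 2 * real (card J) * \<delta>\<^sup>2 + 8 * real N"
  have C0: "0 \<le> C" by (simp add: C_def)
  have psf: "product_sigma_finite (\<lambda>_::nat. M)"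
    by (simp add: product_sigma_finite_def sigma_finite_measure_axioms)
  let ?\<Phi> = "\<lambda>z. SUP h\<in>H. ennreal ((\<Sum>j\<in>J. h (z j) - h (z (j + k)))\<^sup>2)"
  let ?A = "\<lambda>S z. SUP h\<in>H. ennreal ((\<Sum>j\<in>J. signed S j (h (z j)))\<^sup>2)"
  have disj: "J \<inter> shifted = {}" using J by auto
  have fin: "finite shifted" using J by simp
  have mH: "(\<lambda>z. h (z i)) \<in> borel_measurable doubled" if "h \<in> H" "i \<in> J \<union> shifted" for h i
    using that by (rule measurable_H_component)
  have m\<Phi>: "?\<Phi> \<in> borel_measurable doubled"
    using H by (intro borel_measurable_SUP measurable_compose[OF _ measurable_ennreal]
         borel_measurable_power borel_measurable_sum borel_measurable_diff mH) auto
  have mS: "(\<lambda>z. SUP h\<in>H. ennreal ((\<Sum>j\<in>J. signed S j (h (z j) - h (z (j + k))))\<^sup>2))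
      \<in> borel_measurable doubled" for S
    using H by (intro borel_measurable_SUP measurable_compose[OF _ measurable_ennreal]
         borel_measurable_power borel_measurable_sum borel_measurable_diff borel_measurable_uminus mH
         measurable_If) auto
  have "(\<integral>\<^sup>+x. (SUP h\<in>H. ennreal ((\<Sum>j\<in>J. h (x j) - expectation h)\<^sup>2)) \<partial>PiM J (\<lambda>_. M))
    \<le> (\<integral>\<^sup>+x. \<integral>\<^sup>+y. (SUP h\<in>H. ennreal ((\<Sum>j\<in>J. h (x j) - h (y (j + k)))\<^sup>2)) \<partial>PiM shifted (\<lambda>_. M) \<partial>PiM J (\<lambda>_. M))"
    by (rule nn_integral_mono) (rule centered_le_ghost)
  \<comment> \<open>\<open>merge\<close> glues sample and ghost into one point of the doubled
    product, where coordinates can be exchanged.\<close>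
  also have "\<dots> = (\<integral>\<^sup>+x. \<integral>\<^sup>+y. ?\<Phi> (merge J shifted (x, y)) \<partial>PiM shifted (\<lambda>_. M) \<partial>PiM J (\<lambda>_. M))"
    using disj by (intro nn_integral_cong SUP_cong refl arg_cong[where f = "\<lambda>x. ennreal (x\<^sup>2)"] sum.cong) auto
  also have "\<dots> = (\<integral>\<^sup>+z. ?\<Phi> z \<partial>doubled)"
    by (rule product_sigma_finite.product_nn_integral_fold[OF psf disj J(1) fin m\<Phi>, symmetric])
  finally have 1: "(\<integral>\<^sup>+x. (SUP h\<in>H. ennreal ((\<Sum>j\<in>J. h (x j) - expectation h)\<^sup>2)) \<partial>PiM J (\<lambda>_. M))
    \<le> (\<integral>\<^sup>+z. ?\<Phi> z \<partial>doubled)" .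
  \<comment> \<open>Sample and ghost are separated only after the signs are in place, and the cover
    is applied to each half by itself. So covers of samples indexed by \<open>J\<close> suffice, and
    the two halves may use different ones.\<close>
  have pt: "(\<Sum>S\<in>Pow J. SUP h\<in>H. ennreal ((\<Sum>j\<in>J. signed S j (h (z j) - h (z (j + k))))\<^sup>2))
      \<le> ennreal (2 ^ card J * (2 * C)) * (\<Sum>j\<in>J. ennreal ((e (z j))\<^sup>2) + ennreal ((e (z (j + k)))\<^sup>2))"
    (is "?L \<le> ?R")
    if z: "z \<in> space doubled" for z
  proof -
    let ?B = "\<lambda>S. SUP h\<in>H. ennreal ((\<Sum>j\<in>J. signed S j (h (z (j + k))))\<^sup>2)"
    have "?L \<le> (\<Sum>S\<in>Pow J. 2 * ?A S z + 2 * ?B S)"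
    proof (intro sum_mono SUP_least)
      fix S h assume h: "h \<in> H"
      let ?a = "\<Sum>j\<in>J. signed S j (h (z j))" and ?b = "\<Sum>j\<in>J. signed S j (h (z (j + k)))"
      have "(\<Sum>j\<in>J. signed S j (h (z j) - h (z (j + k)))) = ?a - ?b"
        unfolding sum_subtractf[symmetric] by (rule sum.cong) auto
      then have "ennreal ((\<Sum>j\<in>J. signed S j (h (z j) - h (z (j + k))))\<^sup>2) \<le> ennreal (2 * ?a\<^sup>2 + 2 * ?b\<^sup>2)"
        by (simp only:) (intro ennreal_leI square_diff_le)
      also have "\<dots> = 2 * ennreal (?a\<^sup>2) + 2 * ennreal (?b\<^sup>2)"
        by (simp add: ennreal_plus ennreal_mult)
      also have "\<dots> \<le> 2 * ?A S z + 2 * ?B S"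
        using h by (intro add_mono mult_left_mono SUP_upper) auto
      finally show "ennreal ((\<Sum>j\<in>J. signed S j (h (z j) - h (z (j + k))))\<^sup>2) \<le> 2 * ?A S z + 2 * ?B S" .
    qed
    also have "\<dots> = 2 * (\<Sum>S\<in>Pow J. ?A S z) + 2 * (\<Sum>S\<in>Pow J. ?B S)"
      by (simp add: sum.distrib sum_distrib_left)
    also have "\<dots> \<le> 2 * ennreal (2 ^ card J * (C * (\<Sum>j\<in>J. (e (z j))\<^sup>2)))
                 + 2 * ennreal (2 ^ card J * (C * (\<Sum>j\<in>J. (e (z (j + k)))\<^sup>2)))"
      unfolding C_def using z
      by (intro add_mono mult_left_mono sum_signs_sample_le sum_signs_sample_le[of "\<lambda>j. z (j + k)"])
         (auto simp: space_PiM)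
    also have "\<dots> = ?R"
    proof -
      define a where "a = (\<Sum>j\<in>J. (e (z j))\<^sup>2)"
      define b where "b = (\<Sum>j\<in>J. (e (z (j + k)))\<^sup>2)"
      have ab: "0 \<le> a" "0 \<le> b" by (simp_all add: a_def b_def sum_nonneg)
      have two: "2 * ennreal c = ennreal (2 * c)" for c by (simp add: ennreal_mult')
      have "(\<Sum>j\<in>J. ennreal ((e (z j))\<^sup>2) + ennreal ((e (z (j + k)))\<^sup>2)) = ennreal (a + b)"
        unfolding a_def b_def by (simp add: sum.distrib sum_nonneg)
      moreover have "2 * ennreal (2 ^ card J * (C * a)) + 2 * ennreal (2 ^ card J * (C * b))
          = ennreal (2 * (2 ^ card J * (C * a)) + 2 * (2 ^ card J * (C * b)))"
        unfolding two using ab C0 by (intro ennreal_plus[symmetric]) auto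
      moreover have "ennreal (2 ^ card J * (2 * C)) * ennreal (a + b)
          = ennreal (2 ^ card J * (2 * C) * (a + b))"
        using ab C0 by (intro ennreal_mult[symmetric]) auto
      moreover have "2 * (2 ^ card J * (C * a)) + 2 * (2 ^ card J * (C * b)) = 2 ^ card J * (2 * C) * (a + b)"
        by (simp add: distrib_left)
      ultimately show ?thesis by (simp only: a_def b_def)
    qed
    finally show ?thesis .
  qed
  have "ennreal (2 ^ card J) * (\<integral>\<^sup>+z. ?\<Phi> z \<partial>doubled) = (\<Sum>S\<in>Pow J. \<integral>\<^sup>+z. ?\<Phi> z \<partial>doubled)"
    using J ennreal_of_nat_eq_real_of_nat[of "2 ^ card J"] by (simp add: card_Pow)
  also have "\<dots> = (\<Sum>S\<in>Pow J. \<integral>\<^sup>+z. (SUP h\<in>H. ennreal ((\<Sum>j\<in>J. signed S j (h (z j) - h (z (j + k))))\<^sup>2)) \<partial>doubled)"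
    by (rule sum.cong[OF refl], rule ghost_sign_invariant) auto
  also have "\<dots> = (\<integral>\<^sup>+z. (\<Sum>S\<in>Pow J. SUP h\<in>H. ennreal ((\<Sum>j\<in>J. signed S j (h (z j) - h (z (j + k))))\<^sup>2)) \<partial>doubled)"
    by (rule nn_integral_sum[symmetric]) (rule mS)
  also have "\<dots> \<le> (\<integral>\<^sup>+z. ennreal (2 ^ card J * (2 * C)) * (\<Sum>j\<in>J. ennreal ((e (z j))\<^sup>2) + ennreal ((e (z (j + k)))\<^sup>2)) \<partial>doubled)"
    by (rule nn_integral_mono) (rule pt)
  also have "\<dots> = ennreal (2 ^ card J * (2 * C)) * (\<Sum>j\<in>J. (\<integral>\<^sup>+z. ennreal ((e (z j))\<^sup>2) \<partial>doubled) + (\<integral>\<^sup>+z. ennreal ((e (z (j + k)))\<^sup>2) \<partial>doubled))"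
  proof -
    have me: "(\<lambda>z. ennreal ((e (z i))\<^sup>2)) \<in> borel_measurable doubled" if "i \<in> J \<union> shifted" for i
      using that e by (intro measurable_compose[OF _ measurable_ennreal] borel_measurable_power
          measurable_PiM_component_rev)
    have me2: "(\<lambda>z. ennreal ((e (z j))\<^sup>2) + ennreal ((e (z (j + k)))\<^sup>2)) \<in> borel_measurable doubled"
      if "j \<in> J" for j
      using that by (intro borel_measurable_add me) auto
    have "(\<integral>\<^sup>+z. ennreal (2 ^ card J * (2 * C)) * (\<Sum>j\<in>J. ennreal ((e (z j))\<^sup>2) + ennreal ((e (z (j + k)))\<^sup>2)) \<partial>doubled)
        = ennreal (2 ^ card J * (2 * C)) * (\<integral>\<^sup>+z. (\<Sum>j\<in>J. ennreal ((e (z j))\<^sup>2) + ennreal ((e (z (j + k)))\<^sup>2)) \<partial>doubled)"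
      by (rule nn_integral_cmult) (rule borel_measurable_sum[OF me2])
    also have "(\<integral>\<^sup>+z. (\<Sum>j\<in>J. ennreal ((e (z j))\<^sup>2) + ennreal ((e (z (j + k)))\<^sup>2)) \<partial>doubled)
        = (\<Sum>j\<in>J. \<integral>\<^sup>+z. ennreal ((e (z j))\<^sup>2) + ennreal ((e (z (j + k)))\<^sup>2) \<partial>doubled)"
      by (rule nn_integral_sum) (rule me2)
    also have "\<dots> = (\<Sum>j\<in>J. (\<integral>\<^sup>+z. ennreal ((e (z j))\<^sup>2) \<partial>doubled) + (\<integral>\<^sup>+z. ennreal ((e (z (j + k)))\<^sup>2) \<partial>doubled))"
      by (intro sum.cong refl nn_integral_add me) auto
    finally show ?thesis .
  qed
  also have "\<dots> = ennreal (2 ^ card J * (2 * C)) * (\<Sum>j\<in>J. 2 * ennreal (expectation (\<lambda>x. (e x)\<^sup>2)))"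
  proof -
    have c: "(\<integral>\<^sup>+z. ennreal ((e (z i))\<^sup>2) \<partial>doubled) = ennreal (expectation (\<lambda>x. (e x)\<^sup>2))" if "i \<in> J \<union> shifted" for i
      using nn_integral_PiM_component[OF that, of "\<lambda>x. ennreal ((e x)\<^sup>2)"]
      by (simp add: nn_integral_eq_integral int)
    have "(\<integral>\<^sup>+z. ennreal ((e (z j))\<^sup>2) \<partial>doubled) + (\<integral>\<^sup>+z. ennreal ((e (z (j + k)))\<^sup>2) \<partial>doubled)
        = 2 * ennreal (expectation (\<lambda>x. (e x)\<^sup>2))" if "j \<in> J" for j
    proof -
      have "j \<in> J \<union> shifted" "j + k \<in> J \<union> shifted" using that by auto
      then show ?thesis by (simp only: c mult_2)
    qed
    then show ?thesis by (simp cong: sum.cong)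
  qed
  also have "\<dots> = ennreal (2 ^ card J) * ennreal (4 * C * real (card J) * expectation (\<lambda>x. (e x)\<^sup>2))"
  proof -
    define E where "E = expectation (\<lambda>x. (e x)\<^sup>2)"
    have E0: "0 \<le> E" by (simp add: E_def)
    have "(\<Sum>j\<in>J. 2 * ennreal E) = ennreal (real (card J)) * ennreal (2 * E)"
      by (simp add: ennreal_of_nat_eq_real_of_nat ennreal_mult')
    also have "\<dots> = ennreal (real (card J) * (2 * E))"
      using E0 by (intro ennreal_mult[symmetric]) auto
    finally have "ennreal (2 ^ card J * (2 * C)) * (\<Sum>j\<in>J. 2 * ennreal E)
        = ennreal (2 ^ card J * (2 * C) * (real (card J) * (2 * E)))"
      using C0 E0 by (simp only:) (intro ennreal_mult[symmetric]; simp)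
    also have "2 ^ card J * (2 * C) * (real (card J) * (2 * E)) = 2 ^ card J * (4 * C * real (card J) * E)"
      by simp
    also have "ennreal \<dots> = ennreal (2 ^ card J) * ennreal (4 * C * real (card J) * E)"
      using C0 E0 by (intro ennreal_mult) auto
    finally show ?thesis by (simp only: E_def)
  qed
  finally have "(\<integral>\<^sup>+z. ?\<Phi> z \<partial>doubled) \<le> ennreal (4 * C * real (card J) * expectation (\<lambda>x. (e x)\<^sup>2))"
    by (subst (asm) ennreal_mult_le_mult_iff) simp_all
  with 1 show ?thesis unfolding C_def by (rule order_trans)
qed

end

end

section \<open>Empirical covers\<close>

text \<open>The entropy bound is applied to the empirical measure of the points: its squared
  \<open>L2_norm\<close> is the sum over the sample divided by \<open>card J\<close>, a factor that
  cancels. As the bound holds for all \<open>Q\<close> at once, \<open>N\<close> is fixed before the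
  sample is.\<close>

lemma vc_type_empirical_cover:
  fixes E :: "'z \<Rightarrow> real"
  assumes vc: "vc_type S \<F> E" and \<delta>: "0 < \<delta>" "\<delta> \<le> 1"
  obtains N :: nat where "\<And>(J :: nat set) z. finite J \<Longrightarrow> z \<in> J \<rightarrow> space S \<Longrightarrow>
    \<exists>G::('z \<Rightarrow> real) set. finite G \<and> card G \<le> N \<and>
      (\<forall>f\<in>\<F>. \<exists>g\<in>G. (\<Sum>j\<in>J. (f (z j) - g (z j))\<^sup>2) \<le> \<delta>\<^sup>2 * (\<Sum>j\<in>J. (E (z j))\<^sup>2))"
proof -
  have E[measurable]: "E \<in> borel_measurable S" and env: "\<And>f z. f \<in> \<F> \<Longrightarrow> z \<in> space S \<Longrightarrow> \<bar>f z\<bar> \<le> E z"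
    using vc by (auto simp: vc_type_def)
  obtain A v where Av: "(SUP Q \<in> {Q. prob_space Q \<and> sets Q = sets S \<and> square_integrable Q E \<and> 0 < L2_norm Q E}.
           covering_number (\<delta> * L2_norm Q E) \<F> Q) \<le> ennreal ((A / \<delta>) powr v)"
    using vc \<delta> unfolding vc_type_def by blast
  define c where "c = (A / \<delta>) powr v"
  \<comment> \<open>\<open>c\<close> bounds an infimum, and passing to the strictly larger
    \<open>c + 1\<close> yields an actual cover below it. It also makes \<open>N\<close> at least 1,
    as the degenerate sample requires.\<close>
  define N where "N = nat \<lceil>c + 1\<rceil>"
  have c0: "0 \<le> c" by (simp add: c_def)
  have N1: "1 \<le> N" using c0 unfolding N_def by linarith
  show thesis
  proof (rule that[of N])
    fix J :: "nat set" and z assume J: "finite J" and z: "z \<in> J \<rightarrow> space S"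
    define B where "B = (\<Sum>j\<in>J. (E (z j))\<^sup>2)"
    have B0: "0 \<le> B" by (simp add: B_def sum_nonneg)
    show "\<exists>G::('z \<Rightarrow> real) set. finite G \<and> card G \<le> N \<and>
      (\<forall>f\<in>\<F>. \<exists>g\<in>G. (\<Sum>j\<in>J. (f (z j) - g (z j))\<^sup>2) \<le> \<delta>\<^sup>2 * (\<Sum>j\<in>J. (E (z j))\<^sup>2))"
    proof (cases "B = 0")
      case True
      \<comment> \<open>An envelope vanishing on the sample has norm 0, a case excluded from the
        entropy supremum. All members of the class then vanish on the sample too, so the zero
        function covers them.\<close>
      have zero: "f (z j) = 0" if "f \<in> \<F>" "j \<in> J" for f j
      proof -
        have "E (z j) = 0" using True J that by (simp add: B_def sum_nonneg_eq_0_iff)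
        then show ?thesis using env[OF that(1), of "z j"] z that by auto
      qed
      then show ?thesis
        using N1 by (intro exI[of _ "{\<lambda>_. 0}"]) (simp add: zero sum_nonneg)
    next
      case False
      then have Bp: "0 < B" using B0 by simp
      have Jne: "J \<noteq> {}" using False by (auto simp: B_def)
      have m: "0 < real (card J)" using J Jne by (simp add: card_gt_0_iff)
      let ?U = "uniform_count_measure J"
      \<comment> \<open>Points may repeat: the image of the uniform measure on \<open>J\<close>
        counts each value with its multiplicity, as the sums over \<open>J\<close> do.\<close>
      define Q where "Q = distr ?U S z"
      have zm: "z \<in> ?U \<rightarrow>\<^sub>M S"
        using z by (auto simp: measurable_def space_uniform_count_measure sets_uniform_count_measure)
      interpret U: prob_space ?U by (rule prob_space_uniform_count_measure[OF J Jne])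
      have pQ: "prob_space Q" unfolding Q_def by (rule U.prob_space_distr[OF zm])
      have sQ[measurable_cong, simp]: "sets Q = sets S" by (simp add: Q_def)
      have intQ: "integrable Q h" "(\<integral>x. h x \<partial>Q) = (\<Sum>j\<in>J. h (z j)) / real (card J)"
        if "h \<in> borel_measurable S" for h :: "'z \<Rightarrow> real"
        unfolding Q_def integrable_distr_eq[OF zm that] integral_distr[OF zm that]
        using J by (simp_all add: integral_uniform_count_measure)
          (simp add: uniform_count_measure_def integrable_point_measure_finite)
      have L2: "(L2_norm Q h)\<^sup>2 = (\<Sum>j\<in>J. (h (z j))\<^sup>2) / real (card J)"
        if [measurable]: "h \<in> borel_measurable S" for h :: "'z \<Rightarrow> real"
        unfolding L2_norm_def by (subst real_sqrt_pow2) (simp_all add: intQ sum_nonneg)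
      have L2p: "0 < L2_norm Q E"
        using m Bp by (simp add: L2_norm_def intQ B_def[symmetric])
      have "square_integrable Q E"
        by (simp add: square_integrable_def intQ)
      then have "covering_number (\<delta> * L2_norm Q E) \<F> Q \<le> ennreal c"
        using pQ L2p unfolding c_def by (intro order_trans[OF SUP_upper Av]) simp
      also have "\<dots> < ennreal (c + 1)" using c0 by (simp add: ennreal_less_iff)
      finally obtain G where G: "finite G" "of_nat (card G) < ennreal (c + 1)"
        "\<And>f. f \<in> \<F> \<Longrightarrow> \<exists>g\<in>G. square_integrable Q (\<lambda>z. f z - g z) \<and>
             L2_norm Q (\<lambda>z. f z - g z) < \<delta> * L2_norm Q E"
        unfolding covering_number_def INF_less_iff by blast
      have "real (card G) < c + 1"
        using G(2) unfolding ennreal_of_nat_eq_real_of_nat by (simp only: ennreal_less_iff of_nat_0_le_iff)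
      then have "card G \<le> N" unfolding N_def by linarith
      moreover have "\<exists>g\<in>G. (\<Sum>j\<in>J. (f (z j) - g (z j))\<^sup>2) \<le> \<delta>\<^sup>2 * (\<Sum>j\<in>J. (E (z j))\<^sup>2)"
        if f: "f \<in> \<F>" for f
      proof -
        obtain g where g: "g \<in> G" "square_integrable Q (\<lambda>z. f z - g z)"
          "L2_norm Q (\<lambda>z. f z - g z) < \<delta> * L2_norm Q E" using G(3)[OF f] by blast
        have gm: "(\<lambda>z. f z - g z) \<in> borel_measurable S"
          using g(2) unfolding square_integrable_def measurable_cong_sets[OF sQ refl] by blast
        have "(L2_norm Q (\<lambda>z. f z - g z))\<^sup>2 \<le> (\<delta> * L2_norm Q E)\<^sup>2"
          using g(3) by (intro power_mono) (auto simp: L2_norm_def)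
        then have "(\<Sum>j\<in>J. (f (z j) - g (z j))\<^sup>2) \<le> \<delta>\<^sup>2 * (\<Sum>j\<in>J. (E (z j))\<^sup>2)"
          using m by (simp add: power_mult_distrib L2[OF gm] L2[OF E] divide_right_mono field_simps)
        then show ?thesis using g(1) by blast
      qed
      ultimately show ?thesis using G(1) by blast
    qed
  qed
qed

section \<open>The sample seen from a node\<close>

lemma Int_stable_vimages: "Int_stable {X -` B \<inter> \<Omega> | B. B \<in> sets N}"
proof (rule Int_stableI, clarify)
  fix B B' assume "B \<in> sets N" "B' \<in> sets N"
  then show "\<exists>D. X -` B \<inter> \<Omega> \<inter> (X -` B' \<inter> \<Omega>) = X -` D \<inter> \<Omega> \<and> D \<in> sets N"
    by (intro exI[of _ "B \<inter> B'"]) auto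
qed

context dyadic_array
begin

definition DU where "DU = distr M MU (U 1)"
definition DV where "DV = distr M MV (V 1 2)"

lemma prob_space_DU: "prob_space DU"
  unfolding DU_def by (rule prob_space_distr) (simp add: U_measurable)

lemma prob_space_DV: "prob_space DV"
  unfolding DV_def by (rule prob_space_distr) (simp add: V_measurable)

lemma prob_space_DUV: "prob_space (DU \<Otimes>\<^sub>M DV)"
proof -
  interpret U: prob_space DU by (rule prob_space_DU)
  interpret V: prob_space DV by (rule prob_space_DV)
  interpret pair_prob_space DU DV ..
  show ?thesis by unfold_locales
qed

lemma sets_DUV: "sets (DU \<Otimes>\<^sub>M DV) = sets (MU \<Otimes>\<^sub>M MV)"
  by (simp add: DU_def DV_def cong: sets_pair_measure_cong)

lemma pair_measurable:
  assumes "1 \<le> i" "1 \<le> k" "k < l"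
  shows "(\<lambda>\<omega>. (U i \<omega>, V k l \<omega>)) \<in> M \<rightarrow>\<^sub>M MU \<Otimes>\<^sub>M MV"
  using assms by (intro measurable_Pair U_measurable V_measurable)

lemma distr_node_dyad:
  assumes i: "1 \<le> i" and kl: "1 \<le> k" "k < l"
  shows "distr M (MU \<Otimes>\<^sub>M MV) (\<lambda>\<omega>. (U i \<omega>, V k l \<omega>)) = DU \<Otimes>\<^sub>M DV"
proof (rule pair_measure_eqI[symmetric])
  show "sigma_finite_measure DU" "sigma_finite_measure DV"
    using prob_space_DU prob_space_DV by (auto intro: prob_space_imp_sigma_finite)
  show "sets (DU \<Otimes>\<^sub>M DV) = sets (distr M (MU \<Otimes>\<^sub>M MV) (\<lambda>\<omega>. (U i \<omega>, V k l \<omega>)))"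
    by (simp add: sets_DUV)
  fix A B assume "A \<in> sets DU" "B \<in> sets DV"
  then have A: "A \<in> sets MU" and B: "B \<in> sets MV" by (simp_all add: DU_def DV_def)
  let ?A = "U i -` A \<inter> space M" and ?B = "V k l -` B \<inter> space M"
  have eA: "emeasure DU A = emeasure M ?A"
    unfolding DU_def U_ident[OF i, symmetric] using A i by (simp add: emeasure_distr U_measurable)
  have eB: "emeasure DV B = emeasure M ?B"
    unfolding DV_def V_ident[OF kl, symmetric] using B kl by (simp add: emeasure_distr V_measurable)
  have "prob (\<Inter>j\<in>{Inl i, Inr (k, l)}. case_sum (\<lambda>_. ?A) (\<lambda>_. ?B) j)
      = (\<Prod>j\<in>{Inl i, Inr (k, l)}. prob (case_sum (\<lambda>_. ?A) (\<lambda>_. ?B) j))"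
    by (rule indep_setsD[OF UV_indep]) (use i kl A B in auto)
  then have p: "prob (?A \<inter> ?B) = prob ?A * prob ?B" by simp
  have eq: "(\<lambda>\<omega>. (U i \<omega>, V k l \<omega>)) -` (A \<times> B) \<inter> space M = ?A \<inter> ?B" by auto
  show "emeasure DU A * emeasure DV B
      = emeasure (distr M (MU \<Otimes>\<^sub>M MV) (\<lambda>\<omega>. (U i \<omega>, V k l \<omega>))) (A \<times> B)"
    using A B by (subst emeasure_distr[OF pair_measurable[OF i kl]])
      (simp_all add: eq eA eB emeasure_eq_measure p ennreal_mult)
qed

text \<open>The independent node and dyad events are regrouped into blocks of one node and one dyad;
  injectivity of \<open>p\<close> makes the blocks disjoint, so the sigma-algebras they generate are
  independent.\<close>

lemma indep_vars_node_dyad: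
  assumes p: "\<And>i. i \<in> I \<Longrightarrow> 1 \<le> i \<and> 1 \<le> fst (p i) \<and> fst (p i) < snd (p i)"
    and inj: "inj_on p I"
  shows "indep_vars (\<lambda>_. MU \<Otimes>\<^sub>M MV) (\<lambda>i \<omega>. (U i \<omega>, V (fst (p i)) (snd (p i)) \<omega>)) I"
proof -
  let ?E = "case_sum (\<lambda>i. {U i -` B \<inter> space M | B. B \<in> sets MU})
                  (\<lambda>(i, j). {V i j -` B \<inter> space M | B. B \<in> sets MV})"
  define K :: "nat \<Rightarrow> (nat + nat \<times> nat) set" where "K i = {Inl i, Inr (p i)}" for i
  let ?S = "\<lambda>i. sigma_sets (space M) (\<Union>k\<in>K i. ?E k)"
  let ?W = "\<lambda>i \<omega>. (U i \<omega>, V (fst (p i)) (snd (p i)) \<omega>)"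
  have ind: "indep_sets ?S I"
  proof (rule indep_sets_collect_sigma)
    show "indep_sets ?E (\<Union>j\<in>I. K j)"
      using p by (intro indep_sets_mono_index[OF _ UV_indep]) (force simp: K_def)
    show "disjoint_family_on K I"
      using inj by (auto simp: disjoint_family_on_def K_def dest: inj_onD)
    show "Int_stable (?E i)" if "i \<in> K j" for i j
      by (cases i) (auto intro: Int_stable_vimages split: prod.split)
  qed
  have "{?W i -` C \<inter> space M | C. C \<in> sets (MU \<Otimes>\<^sub>M MV)} \<subseteq> ?S i" if i: "i \<in> I" for i
  proof -
    define N where "N = sigma (space M) (\<Union>k\<in>K i. ?E k)"
    have sub: "(\<Union>k\<in>K i. ?E k) \<subseteq> Pow (space M)" by (auto simp: K_def split: prod.splits)
    have spN: "space N = space M" and seN: "sets N = ?S i"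
      using sub by (auto simp: N_def)
    obtain k l where kl: "p i = (k, l)" by (cases "p i")
    have "U i \<in> N \<rightarrow>\<^sub>M MU"
      using measurable_space[OF U_measurable[of i]] p[OF i]
      by (intro measurableI) (auto simp: spN seN K_def intro!: sigma_sets.Basic)
    moreover have "V k l \<in> N \<rightarrow>\<^sub>M MV"
      using measurable_space[OF V_measurable[of k l]] p[OF i]
      by (intro measurableI) (auto simp: kl spN seN K_def intro!: sigma_sets.Basic)
    ultimately have "(\<lambda>\<omega>. (U i \<omega>, V k l \<omega>)) \<in> N \<rightarrow>\<^sub>M MU \<Otimes>\<^sub>M MV"
      by (rule measurable_Pair)
    then have "?W i \<in> N \<rightarrow>\<^sub>M MU \<Otimes>\<^sub>M MV" by (simp add: kl)
    from measurable_sets[OF this] show ?thesis by (auto simp: spN seN)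
  qed
  then show ?thesis
    unfolding indep_vars_def2 using p
    by (auto intro!: indep_sets_mono_sets[OF ind] pair_measurable)
qed

text \<open>
  The independence structure seen from node \<open>i\<close>: every other node \<open>j\<close> is paired with the dyad
  \<open>{i, j}\<close>, and node \<open>i\<close> itself with a dyad outside \<open>{1..n}\<close>, which plays no role.
\<close>

definition star_dyad :: "nat \<Rightarrow> nat \<Rightarrow> nat \<Rightarrow> nat \<times> nat" where
  "star_dyad n i j = (if j = i then (n + 1, n + 2) else (min i j, max i j))"

definition star :: "nat \<Rightarrow> nat \<Rightarrow> 'w \<Rightarrow> nat \<Rightarrow> 'u \<times> 'v" where
  "star n i \<omega> = (\<lambda>j\<in>{1..n}. (U j \<omega>, V (fst (star_dyad n i j)) (snd (star_dyad n i j)) \<omega>))"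

lemma star_dyad_valid:
  "i \<in> {1..n} \<Longrightarrow> j \<in> {1..n} \<Longrightarrow>
    1 \<le> j \<and> 1 \<le> fst (star_dyad n i j) \<and> fst (star_dyad n i j) < snd (star_dyad n i j)"
  by (auto simp: star_dyad_def)

lemma star_measurable:
  assumes "i \<in> {1..n}"
  shows "star n i \<in> M \<rightarrow>\<^sub>M PiM {1..n} (\<lambda>_. MU \<Otimes>\<^sub>M MV)"
  unfolding star_def using star_dyad_valid[OF assms]
  by (intro measurable_restrict pair_measurable) auto

lemma distr_star:
  assumes i: "i \<in> {1..n}"
  shows "distr M (PiM {1..n} (\<lambda>_. MU \<Otimes>\<^sub>M MV)) (star n i) = PiM {1..n} (\<lambda>_. DU \<Otimes>\<^sub>M DV)"
proof -
  let ?p = "star_dyad n i"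
  let ?W = "\<lambda>j \<omega>. (U j \<omega>, V (fst (?p j)) (snd (?p j)) \<omega>)"
  have "indep_vars (\<lambda>_. MU \<Otimes>\<^sub>M MV) ?W {1..n}"
  proof (rule indep_vars_node_dyad)
    \<comment> \<open>For fixed \<open>i\<close> the dyads \<open>{i, j}\<close> are distinct, and
      the placeholder joins nodes beyond \<open>n\<close>, so it coincides with none of
      them.\<close>
    show "inj_on ?p {1..n}"
      using i by (auto simp: inj_on_def star_dyad_def min_def max_def split: if_splits)
  qed (rule star_dyad_valid[OF i])
  moreover have "?W j \<in> M \<rightarrow>\<^sub>M MU \<Otimes>\<^sub>M MV" if "j \<in> {1..n}" for j
    using star_dyad_valid[OF i that] by (intro pair_measurable) auto
  ultimately have "distr M (PiM {1..n} (\<lambda>_. MU \<Otimes>\<^sub>M MV)) (star n i)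
      = PiM {1..n} (\<lambda>j. distr M (MU \<Otimes>\<^sub>M MV) (?W j))"
    unfolding star_def using i by (subst (asm) indep_vars_iff_distr_eq_PiM') auto
  also have "\<dots> = PiM {1..n} (\<lambda>_. DU \<Otimes>\<^sub>M DV)"
    using star_dyad_valid[OF i] by (intro PiM_cong refl distr_node_dyad) auto
  finally show ?thesis .
qed

text \<open>Symmetry of \<tau> lets node \<open>i\<close> be the first argument whichever index is
  smaller.\<close>

lemma Z_star:
  assumes i: "i \<in> {1..n}" and j: "j \<in> {1..n}" "j \<noteq> i" and \<omega>: "\<omega> \<in> space M"
  shows "Z i j \<omega> = \<tau> (fst (star n i \<omega> i)) (fst (star n i \<omega> j)) (snd (star n i \<omega> j))"
proof (cases "i < j")
  case True
  then show ?thesis using assms by (simp add: star_def star_dyad_def Z_eq)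
next
  case False
  then have ji: "j < i" using j by simp
  then have "U i \<omega> \<in> space MU" "U j \<omega> \<in> space MU" "V j i \<omega> \<in> space MV"
    using i j \<omega> U_measurable V_measurable by (auto intro!: measurable_space[where M = M])
  then have "\<tau> (U j \<omega>) (U i \<omega>) (V j i \<omega>) = \<tau> (U i \<omega>) (U j \<omega>) (V j i \<omega>)"
    by (intro tau_sym)
  moreover have "Z i j \<omega> = \<tau> (U j \<omega>) (U i \<omega>) (V j i \<omega>)"
    using Z_flip[of j i \<omega>] Z_eq[of j i \<omega>] ji j \<omega> by simp
  ultimately show ?thesis
    using i j ji by (simp add: star_def star_dyad_def)
qed

section \<open>Conditional means and integration over the star of a node\<close>

definition cond_mean :: "(real \<times> (real ^ 'd) \<Rightarrow> real) \<Rightarrow> 'u \<Rightarrow> real" where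
  "cond_mean f u = (\<integral>w. f (\<tau> u (fst w) (snd w)) \<partial>(DU \<Otimes>\<^sub>M DV))"

lemma fst_space: "y \<in> space (DU \<Otimes>\<^sub>M DV) \<Longrightarrow> fst y \<in> space MU"
  by (auto simp: space_pair_measure DU_def)

lemma tau_joint_measurable:
  "(\<lambda>(u, w). \<tau> u (fst w) (snd w)) \<in> MU \<Otimes>\<^sub>M (MU \<Otimes>\<^sub>M MV) \<rightarrow>\<^sub>M obs_space \<X>"
  using tau_measurable by (simp add: case_prod_beta')

lemma tau_section_measurable:
  assumes "u \<in> space MU"
  shows "(\<lambda>w. \<tau> u (fst w) (snd w)) \<in> DU \<Otimes>\<^sub>M DV \<rightarrow>\<^sub>M obs_space \<X>"
  using measurable_compose[OF measurable_Pair1'[OF assms] tau_joint_measurable]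
  by (simp add: measurable_cong_sets[OF sets_DUV refl])

lemma cond_mean_measurable:
  assumes "f \<in> borel_measurable (obs_space \<X>)"
  shows "cond_mean f \<in> borel_measurable MU"
proof -
  interpret D: prob_space "DU \<Otimes>\<^sub>M DV" by (rule prob_space_DUV)
  have "(\<lambda>(u, w). f (\<tau> u (fst w) (snd w))) \<in> borel_measurable (MU \<Otimes>\<^sub>M (DU \<Otimes>\<^sub>M DV))"
    using measurable_compose[OF tau_joint_measurable assms]
    by (simp add: case_prod_beta' measurable_cong_sets[OF sets_pair_measure_cong[OF refl sets_DUV] refl])
  then show ?thesis
    unfolding cond_mean_def[abs_def] by (rule D.borel_measurable_lebesgue_integral)
qed

lemma node_proj_eq:
  assumes f: "f \<in> borel_measurable (obs_space \<X>)" and u: "u \<in> space MU"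
  shows "node_proj M U V \<tau> Z f u = cond_mean f u - pop_mean M Z f"
proof -
  have m: "(\<lambda>\<omega>. (U 2 \<omega>, V 1 2 \<omega>)) \<in> M \<rightarrow>\<^sub>M MU \<Otimes>\<^sub>M MV" by (rule pair_measurable) auto
  have "(\<lambda>w. f (\<tau> u (fst w) (snd w))) \<in> borel_measurable (MU \<Otimes>\<^sub>M MV)"
    using measurable_compose[OF tau_section_measurable[OF u] f]
    by (simp add: measurable_cong_sets[OF sets_DUV refl])
  then show ?thesis
    unfolding node_proj_def cond_mean_def
    by (subst distr_node_dyad[of 2 1 2, symmetric]) (simp_all add: integral_distr[OF m] del: One_nat_def)
qed

text \<open>This is conditioning on node \<open>i\<close> in the form of Fubini's theorem:
  coordinate \<open>i\<close> is integrated last, and for fixed \<open>y\<close> the other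
  coordinates are i.i.d.\<close>

lemma nn_integral_star:
  assumes i: "i \<in> {1..n}" and \<Psi>: "\<Psi> \<in> borel_measurable (PiM {1..n} (\<lambda>_. MU \<Otimes>\<^sub>M MV))"
  shows "(\<integral>\<^sup>+\<omega>. \<Psi> (star n i \<omega>) \<partial>M)
    = (\<integral>\<^sup>+y. \<integral>\<^sup>+x. \<Psi> (x(i := y)) \<partial>PiM ({1..n} - {i}) (\<lambda>_. DU \<Otimes>\<^sub>M DV) \<partial>(DU \<Otimes>\<^sub>M DV))"
proof -
  interpret D: prob_space "DU \<Otimes>\<^sub>M DV" by (rule prob_space_DUV)
  have psf: "product_sigma_finite (\<lambda>_::nat. DU \<Otimes>\<^sub>M DV)"
    by (simp add: product_sigma_finite_def D.sigma_finite_measure_axioms)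
  have ins: "insert i ({1..n} - {i}) = {1..n}" using i by auto
  have \<Psi>': "\<Psi> \<in> borel_measurable (PiM (insert i ({1..n} - {i})) (\<lambda>_. DU \<Otimes>\<^sub>M DV))"
    using \<Psi> unfolding ins by (simp only: measurable_cong_sets[OF sets_PiM_cong[OF refl sets_DUV] refl])
  have "(\<integral>\<^sup>+\<omega>. \<Psi> (star n i \<omega>) \<partial>M)
      = (\<integral>\<^sup>+x. \<Psi> x \<partial>distr M (PiM {1..n} (\<lambda>_. MU \<Otimes>\<^sub>M MV)) (star n i))"
    by (subst nn_integral_distr[OF star_measurable[OF i]]) (simp_all only: measurable_distr_eq1 \<Psi>)
  also have "\<dots> = (\<integral>\<^sup>+x. \<Psi> x \<partial>PiM (insert i ({1..n} - {i})) (\<lambda>_. DU \<Otimes>\<^sub>M DV))"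
    by (simp only: distr_star[OF i] ins)
  also have "\<dots> = (\<integral>\<^sup>+y. \<integral>\<^sup>+x. \<Psi> (x(i := y)) \<partial>PiM ({1..n} - {i}) (\<lambda>_. DU \<Otimes>\<^sub>M DV) \<partial>(DU \<Otimes>\<^sub>M DV))"
    by (rule product_sigma_finite.product_nn_integral_insert_rev[OF psf _ _ \<Psi>']) auto
  finally show ?thesis .
qed

lemma obs_component_measurable:
  assumes i: "i \<in> K" and j: "j \<in> K" and f: "f \<in> obs_space \<X> \<rightarrow>\<^sub>M N"
  shows "(\<lambda>w. f (\<tau> (fst (w i)) (fst (w j)) (snd (w j)))) \<in> PiM K (\<lambda>_. MU \<Otimes>\<^sub>M MV) \<rightarrow>\<^sub>M N"
proof -
  have "(\<lambda>w. (fst (w i), w j)) \<in> PiM K (\<lambda>_. MU \<Otimes>\<^sub>M MV) \<rightarrow>\<^sub>M MU \<Otimes>\<^sub>M (MU \<Otimes>\<^sub>M MV)"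
    using i j by measurable
  from measurable_compose[OF measurable_compose[OF this tau_joint_measurable] f]
  show ?thesis by simp
qed

text \<open>The star of node 1 among two nodes contains exactly the observation
  \<open>Z 1 2\<close>, so this is \<open>nn_integral_star\<close> with \<open>n = 2\<close>.
  Keeping the dyad component in the outer integral gives the same outer measure as for general
  \<open>n\<close>.\<close>

lemma nn_integral_dyad:
  assumes \<phi>: "\<phi> \<in> borel_measurable (obs_space \<X>)"
  shows "(\<integral>\<^sup>+\<omega>. \<phi> (Z 1 2 \<omega>) \<partial>M)
    = (\<integral>\<^sup>+y. \<integral>\<^sup>+w. \<phi> (\<tau> (fst y) (fst w) (snd w)) \<partial>(DU \<Otimes>\<^sub>M DV) \<partial>(DU \<Otimes>\<^sub>M DV))"
proof -
  interpret D: prob_space "DU \<Otimes>\<^sub>M DV" by (rule prob_space_DUV)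
  let ?\<Psi> = "\<lambda>w::nat \<Rightarrow> 'u \<times> 'v. \<phi> (\<tau> (fst (w 1)) (fst (w 2)) (snd (w 2)))"
  have K: "{1..2::nat} - {1} = {2}" by auto
  have "(\<integral>\<^sup>+\<omega>. \<phi> (Z 1 2 \<omega>) \<partial>M) = (\<integral>\<^sup>+\<omega>. ?\<Psi> (star 2 1 \<omega>) \<partial>M)"
    using Z_star[of 1 2 2] by (intro nn_integral_cong) (simp del: One_nat_def)
  also have "\<dots> = (\<integral>\<^sup>+y. \<integral>\<^sup>+x. ?\<Psi> (x(1 := y)) \<partial>PiM {2::nat} (\<lambda>_. DU \<Otimes>\<^sub>M DV) \<partial>(DU \<Otimes>\<^sub>M DV))"
    using nn_integral_star[of 1 2 ?\<Psi>] obs_component_measurable[OF _ _ \<phi>, of 1 "{1..2::nat}" 2]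
    by (simp add: K del: One_nat_def)
  also have "\<dots> = (\<integral>\<^sup>+y. \<integral>\<^sup>+w. \<phi> (\<tau> (fst y) (fst w) (snd w)) \<partial>(DU \<Otimes>\<^sub>M DV) \<partial>(DU \<Otimes>\<^sub>M DV))"
  proof (rule nn_integral_cong)
    fix y assume "y \<in> space (DU \<Otimes>\<^sub>M DV)"
    then have y: "fst y \<in> space MU" by (rule fst_space)
    have "(\<integral>\<^sup>+x. ?\<Psi> (x(1 := y)) \<partial>PiM {2::nat} (\<lambda>_. DU \<Otimes>\<^sub>M DV))
        = (\<integral>\<^sup>+x. (\<lambda>w. \<phi> (\<tau> (fst y) (fst w) (snd w))) (x (2::nat)) \<partial>PiM {2::nat} (\<lambda>_. DU \<Otimes>\<^sub>M DV))"
      by simp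
    also have "\<dots> = (\<integral>\<^sup>+w. \<phi> (\<tau> (fst y) (fst w) (snd w)) \<partial>(DU \<Otimes>\<^sub>M DV))"
      by (rule D.nn_integral_PiM_component)
         (auto intro: measurable_compose[OF tau_section_measurable[OF y] \<phi>])
    finally show "(\<integral>\<^sup>+x. ?\<Psi> (x(1 := y)) \<partial>PiM {2::nat} (\<lambda>_. DU \<Otimes>\<^sub>M DV))
        = (\<integral>\<^sup>+w. \<phi> (\<tau> (fst y) (fst w) (snd w)) \<partial>(DU \<Otimes>\<^sub>M DV))" .
  qed
  finally show ?thesis .
qed

text \<open>For \<open>i\<close> in \<open>{1..n}\<close> this is \<open>n - 1\<close> times the
  deviation of the node mean from \<open>cond_mean\<close>. Left unnormalized, it is a centred sum
  to which the symmetrization bound applies directly.\<close>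

definition node_dev :: "nat \<Rightarrow> (real \<times> (real ^ 'd) \<Rightarrow> real) \<Rightarrow> nat \<Rightarrow> 'w \<Rightarrow> real" where
  "node_dev n f i \<omega> = (\<Sum>j\<in>{1..n} - {i}. f (Z i j \<omega>) - cond_mean f (U i \<omega>))"

lemma node_dev_star:
  assumes i: "i \<in> {1..n}" and \<omega>: "\<omega> \<in> space M"
  shows "node_dev n f i \<omega> = (\<Sum>j\<in>{1..n} - {i}.
    f (\<tau> (fst (star n i \<omega> i)) (fst (star n i \<omega> j)) (snd (star n i \<omega> j))) - cond_mean f (fst (star n i \<omega> i)))"
  unfolding node_dev_def
proof (rule sum.cong[OF refl])
  fix j assume j: "j \<in> {1..n} - {i}"
  have "fst (star n i \<omega> i) = U i \<omega>" using i by (simp add: star_def)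
  then show "f (Z i j \<omega>) - cond_mean f (U i \<omega>) = f (\<tau> (fst (star n i \<omega> i)) (fst (star n i \<omega> j)) (snd (star n i \<omega> j)))
     - cond_mean f (fst (star n i \<omega> i))"
    using Z_star[OF i, of j \<omega>] j \<omega> by simp
qed

lemma dev_measurable:
  assumes "i \<in> {1..n}" "f \<in> borel_measurable (obs_space \<X>)"
  shows "(\<lambda>w. \<Sum>j\<in>{1..n} - {i}. f (\<tau> (fst (w i)) (fst (w j)) (snd (w j))) - cond_mean f (fst (w i)))
    \<in> borel_measurable (PiM {1..n} (\<lambda>_. MU \<Otimes>\<^sub>M MV))"
proof (intro borel_measurable_sum borel_measurable_diff)
  show "(\<lambda>w. f (\<tau> (fst (w i)) (fst (w j)) (snd (w j)))) \<in> borel_measurable (PiM {1..n} (\<lambda>_. MU \<Otimes>\<^sub>M MV))"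
    if "j \<in> {1..n} - {i}" for j
    using that assms by (intro obs_component_measurable) auto
  have "(\<lambda>w. fst (w i)) \<in> PiM {1..n} (\<lambda>_. MU \<Otimes>\<^sub>M MV) \<rightarrow>\<^sub>M MU"
    using assms(1) by measurable
  then show "(\<lambda>w. cond_mean f (fst (w i))) \<in> borel_measurable (PiM {1..n} (\<lambda>_. MU \<Otimes>\<^sub>M MV))"
    using cond_mean_measurable[OF assms(2)] by (rule measurable_compose)
qed

lemma node_dev_measurable:
  assumes i: "i \<in> {1..n}" and f: "f \<in> borel_measurable (obs_space \<X>)"
  shows "node_dev n f i \<in> borel_measurable M"
  using measurable_compose[OF star_measurable[OF i] dev_measurable[OF i f]]
  by (subst measurable_cong[OF node_dev_star[OF i]])

text \<open>With \<open>U i\<close> frozen at \<open>u\<close>, this is a centred i.i.d. sum over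
  the sections of the class under \<tau>. The cover hypothesis concerns arbitrary points, so it can
  be used at the points \<open>\<tau> u (fst w) (snd w)\<close> and gives the same \<open>N\<close>
  for every \<open>u\<close>; the bound is then integrated over \<open>u\<close>.\<close>

lemma nn_integral_SUP_node_dev_le:
  assumes \<G>: "countable \<G>" and meas: "\<And>f. f \<in> \<G> \<Longrightarrow> f \<in> borel_measurable (obs_space \<X>)"
    and F: "F \<in> borel_measurable (obs_space \<X>)"
    and env: "\<And>f z. f \<in> \<G> \<Longrightarrow> z \<in> space (obs_space \<X>) \<Longrightarrow> \<bar>f z\<bar> \<le> F z"
    and cover: "\<And>(J :: nat set) z. finite J \<Longrightarrow> z \<in> J \<rightarrow> space (obs_space \<X>) \<Longrightarrow>
      \<exists>G::(real \<times> (real ^ 'd) \<Rightarrow> real) set. finite G \<and> card G \<le> N \<and>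
        (\<forall>f\<in>\<G>. \<exists>g\<in>G. (\<Sum>j\<in>J. (f (z j) - g (z j))\<^sup>2) \<le> \<delta>\<^sup>2 * (\<Sum>j\<in>J. (F (z j))\<^sup>2))"
    and \<delta>: "0 < \<delta>" "\<delta> \<le> 1" and i: "i \<in> {1..n}" and n: "2 \<le> n"
  shows "(\<integral>\<^sup>+\<omega>. (SUP f\<in>\<G>. ennreal ((node_dev n f i \<omega>)\<^sup>2)) \<partial>M)
    \<le> ennreal (4 * (2 * (real n - 1) * \<delta>\<^sup>2 + 8 * real N) * (real n - 1)) * (\<integral>\<^sup>+\<omega>. ennreal ((F (Z 1 2 \<omega>))\<^sup>2) \<partial>M)"
proof -
  define J where "J = {1..n} - {i}"
  define C where "C = 4 * (2 * (real n - 1) * \<delta>\<^sup>2 + 8 * real N) * (real n - 1)"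
  let ?D = "DU \<Otimes>\<^sub>M DV"
  interpret D: prob_space ?D by (rule prob_space_DUV)
  have Jk: "finite J" "J \<subseteq> {..<Suc n}" by (auto simp: J_def)
  have cJ: "real (card J) = real n - 1" using i n by (simp add: J_def of_nat_diff)
  have C0: "0 < C" using n \<delta> by (simp add: C_def add_pos_nonneg)
  define \<Psi> where "\<Psi> w = (SUP f\<in>\<G>. ennreal ((\<Sum>j\<in>J. f (\<tau> (fst (w i)) (fst (w j)) (snd (w j)))
      - cond_mean f (fst (w i)))\<^sup>2))" for w :: "nat \<Rightarrow> 'u \<times> 'v"
  have \<Psi>m: "\<Psi> \<in> borel_measurable (PiM {1..n} (\<lambda>_. MU \<Otimes>\<^sub>M MV))"
    unfolding \<Psi>_def[abs_def] J_def using \<G> i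
    by (intro borel_measurable_SUP measurable_compose[OF _ measurable_ennreal]
        borel_measurable_power dev_measurable meas)
  have inner: "(\<integral>\<^sup>+x. \<Psi> (x(i := y)) \<partial>PiM J (\<lambda>_. ?D))
      \<le> ennreal C * (\<integral>\<^sup>+w. ennreal ((F (\<tau> (fst y) (fst w) (snd w)))\<^sup>2) \<partial>?D)"
    if y: "y \<in> space ?D" for y
  proof -
    define u where "u = fst y"
    have u: "u \<in> space MU" using y unfolding u_def by (rule fst_space)
    let ?t = "\<lambda>w. \<tau> u (fst w) (snd w)"
    let ?e = "\<lambda>w. F (?t w)"
    have tm: "?t \<in> ?D \<rightarrow>\<^sub>M obs_space \<X>" by (rule tau_section_measurable[OF u])
    have em: "?e \<in> borel_measurable ?D" by (rule measurable_compose[OF tm F])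
    have e2m: "(\<lambda>w. (?e w)\<^sup>2) \<in> borel_measurable ?D" using em by (rule borel_measurable_power)
    show ?thesis
    proof (cases "(\<integral>\<^sup>+w. ennreal ((?e w)\<^sup>2) \<partial>?D) = \<infinity>")
      \<comment> \<open>For such \<open>u\<close> the section of \<open>F\<close> is not square
        integrable and \<open>cond_mean\<close> may be a default value. The right-hand side is
        infinite, because \<open>C\<close> is strictly positive.\<close>
      case True
      then show ?thesis using C0 by (simp add: u_def ennreal_mult_top)
    next
      case False
      then have int: "integrable ?D (\<lambda>w. (?e w)\<^sup>2)"
        by (intro integrableI_nonneg e2m) (auto simp: less_top)
      define H where "H = (\<lambda>f w. f (?t w)) ` \<G>"
      have "(\<integral>\<^sup>+x. (SUP h\<in>H. ennreal ((\<Sum>j\<in>J. h (x j) - D.expectation h)\<^sup>2)) \<partial>PiM J (\<lambda>_. ?D))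
        \<le> ennreal (4 * (2 * real (card J) * \<delta>\<^sup>2 + 8 * real N) * real (card J) * D.expectation (\<lambda>w. (?e w)\<^sup>2))"
      proof (rule D.nn_integral_SUP_centered_sum_le[OF Jk])
        show "countable H" using \<G> by (simp add: H_def)
        show "h \<in> borel_measurable ?D" if "h \<in> H" for h
          using that measurable_compose[OF tm meas] by (auto simp: H_def)
        show "\<bar>h w\<bar> \<le> ?e w" if "h \<in> H" "w \<in> space ?D" for h w
          using that(1) env measurable_space[OF tm that(2)] unfolding H_def by blast
        fix x assume "x \<in> J \<rightarrow> space ?D"
        then have "(\<lambda>j. ?t (x j)) \<in> J \<rightarrow> space (obs_space \<X>)"
          using measurable_space[OF tm] by (blast intro: funcsetI dest: funcset_mem)
        from cover[OF Jk(1) this] obtain G :: "(real \<times> (real ^ 'd) \<Rightarrow> real) set"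
          where G: "finite G" "card G \<le> N"
            "\<forall>f\<in>\<G>. \<exists>g\<in>G. (\<Sum>j\<in>J. (f (?t (x j)) - g (?t (x j)))\<^sup>2) \<le> \<delta>\<^sup>2 * (\<Sum>j\<in>J. (?e (x j))\<^sup>2)"
          by blast
        \<comment> \<open>Each centre is reduced to the vector of its values at the sample; centres
          that become equal only lower the cardinality.\<close>
        show "\<exists>G::(nat \<Rightarrow> real) set. finite G \<and> card G \<le> N \<and>
          (\<forall>h\<in>H. \<exists>g\<in>G. (\<Sum>j\<in>J. (h (x j) - g j)\<^sup>2) \<le> \<delta>\<^sup>2 * (\<Sum>j\<in>J. (?e (x j))\<^sup>2))"
        proof (intro exI conjI)
          show "finite ((\<lambda>g j. g (?t (x j))) ` G)" using G by simp
          show "card ((\<lambda>g j. g (?t (x j))) ` G) \<le> N" using G card_image_le le_trans by blast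
          show "\<forall>h\<in>H. \<exists>g\<in>(\<lambda>g j. g (?t (x j))) ` G.
              (\<Sum>j\<in>J. (h (x j) - g j)\<^sup>2) \<le> \<delta>\<^sup>2 * (\<Sum>j\<in>J. (?e (x j))\<^sup>2)"
            using G(3) by (simp add: H_def)
        qed
      qed (use em int \<delta> in auto)
      also have "\<dots> = ennreal C * (\<integral>\<^sup>+w. ennreal ((?e w)\<^sup>2) \<partial>?D)"
        unfolding cJ C_def[symmetric] using C0
        by (subst nn_integral_eq_integral[OF int]) (simp_all add: ennreal_mult')
      also have "(\<integral>\<^sup>+x. (SUP h\<in>H. ennreal ((\<Sum>j\<in>J. h (x j) - D.expectation h)\<^sup>2)) \<partial>PiM J (\<lambda>_. ?D))
          = (\<integral>\<^sup>+x. \<Psi> (x(i := y)) \<partial>PiM J (\<lambda>_. ?D))"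
      proof -
        have "(\<Sum>j\<in>J. f (\<tau> (fst ((x(i := y)) i)) (fst ((x(i := y)) j)) (snd ((x(i := y)) j)))
              - cond_mean f (fst ((x(i := y)) i)))
            = (\<Sum>j\<in>J. f (?t (x j)) - D.expectation (\<lambda>w. f (?t w)))" for f x
          by (rule sum.cong) (auto simp: J_def u_def cond_mean_def)
        then show ?thesis by (simp add: \<Psi>_def H_def image_image)
      qed
      finally show ?thesis by (simp add: u_def)
    qed
  qed
  have tm2: "(\<lambda>p. ennreal ((F (\<tau> (fst (fst p)) (fst (snd p)) (snd (snd p))))\<^sup>2)) \<in> borel_measurable (?D \<Otimes>\<^sub>M ?D)"
  proof -
    have "(\<lambda>p. (fst (fst p), snd p)) \<in> (MU \<Otimes>\<^sub>M MV) \<Otimes>\<^sub>M (MU \<Otimes>\<^sub>M MV) \<rightarrow>\<^sub>M MU \<Otimes>\<^sub>M (MU \<Otimes>\<^sub>M MV)"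
      by measurable
    from measurable_compose[OF measurable_compose[OF this tau_joint_measurable] F]
    have "(\<lambda>p. F (\<tau> (fst (fst p)) (fst (snd p)) (snd (snd p)))) \<in> borel_measurable (?D \<Otimes>\<^sub>M ?D)"
      by (simp add: measurable_cong_sets[OF sets_pair_measure_cong[OF sets_DUV sets_DUV] refl])
    then show ?thesis by measurable
  qed
  have "(\<integral>\<^sup>+\<omega>. (SUP f\<in>\<G>. ennreal ((node_dev n f i \<omega>)\<^sup>2)) \<partial>M) = (\<integral>\<^sup>+\<omega>. \<Psi> (star n i \<omega>) \<partial>M)"
    by (intro nn_integral_cong) (simp add: \<Psi>_def node_dev_star[OF i] J_def)
  also have "\<dots> = (\<integral>\<^sup>+y. \<integral>\<^sup>+x. \<Psi> (x(i := y)) \<partial>PiM J (\<lambda>_. ?D) \<partial>?D)"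
    unfolding J_def by (rule nn_integral_star[OF i \<Psi>m])
  also have "\<dots> \<le> (\<integral>\<^sup>+y. ennreal C * (\<integral>\<^sup>+w. ennreal ((F (\<tau> (fst y) (fst w) (snd w)))\<^sup>2) \<partial>?D) \<partial>?D)"
    by (rule nn_integral_mono) (rule inner)
  also have "\<dots> = ennreal C * (\<integral>\<^sup>+y. \<integral>\<^sup>+w. ennreal ((F (\<tau> (fst y) (fst w) (snd w)))\<^sup>2) \<partial>?D \<partial>?D)"
    using D.borel_measurable_nn_integral_fst[OF tm2] by (intro nn_integral_cmult) simp
  also have "(\<integral>\<^sup>+y. \<integral>\<^sup>+w. ennreal ((F (\<tau> (fst y) (fst w) (snd w)))\<^sup>2) \<partial>?D \<partial>?D)
      = (\<integral>\<^sup>+\<omega>. ennreal ((F (Z 1 2 \<omega>))\<^sup>2) \<partial>M)"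
    using F by (intro nn_integral_dyad[symmetric]) measurable
  finally show ?thesis by (simp only: C_def)
qed

end

section \<open>The deviation of the node means\<close>

lemma sum_sq_centered_le:
  fixes a :: "nat \<Rightarrow> real"
  assumes "1 \<le> n"
  shows "(\<Sum>i=1..n. (a i - (1 / real n) * (\<Sum>j=1..n. a j))\<^sup>2) \<le> (\<Sum>i=1..n. (a i)\<^sup>2)"
proof -
  define c where "c = (1 / real n) * (\<Sum>j=1..n. a j)"
  have s: "(\<Sum>j=1..n. a j) = real n * c" using assms by (simp add: c_def)
  have "(\<Sum>i=1..n. (a i - c)\<^sup>2) = (\<Sum>i=1..n. (a i)\<^sup>2 - 2 * c * a i + c\<^sup>2)"
    by (rule sum.cong) (auto simp: power2_eq_square algebra_simps)
  also have "\<dots> = (\<Sum>i=1..n. (a i)\<^sup>2) - 2 * c * (\<Sum>i=1..n. a i) + real n * c\<^sup>2"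
    by (simp add: sum.distrib sum_subtractf sum_distrib_left)
  also have "\<dots> = (\<Sum>i=1..n. (a i)\<^sup>2) - real n * c\<^sup>2"
    unfolding s by (simp add: power2_eq_square)
  also have "\<dots> \<le> (\<Sum>i=1..n. (a i)\<^sup>2)" by simp
  finally show ?thesis by (simp only: c_def)
qed

text \<open>Summing over nodes counts every dyad from both ends; this factor 2 is the one in the
  number \<open>n * (n - 1) / 2\<close> of dyads.\<close>

lemma mean_node_mean_eq_emp_mean:
  fixes Z :: "nat \<Rightarrow> nat \<Rightarrow> 'w \<Rightarrow> 'z"
  assumes n: "2 \<le> n" and sym: "\<And>i j. 1 \<le> j \<Longrightarrow> j < i \<Longrightarrow> Z i j \<omega> = Z j i \<omega>"
  shows "(1 / real n) * (\<Sum>i=1..n. node_mean Z n f i \<omega>) = emp_mean Z n f \<omega>"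
proof -
  let ?L = "{(i, j). 1 \<le> i \<and> i < j \<and> j \<le> n}" and ?G = "{(i, j). 1 \<le> j \<and> j < i \<and> i \<le> n}"
  have fin: "finite ?L" "finite ?G"
    by (rule finite_subset[of _ "{1..n} \<times> {1..n}"]; auto)+
  have "(\<Sum>i=1..n. \<Sum>j\<in>{1..n} - {i}. f (Z i j \<omega>)) = (\<Sum>(i, j)\<in>Sigma {1..n} (\<lambda>i. {1..n} - {i}). f (Z i j \<omega>))"
    by (rule sum.Sigma) auto
  also have "Sigma {1..n} (\<lambda>i. {1..n} - {i}) = ?L \<union> ?G" by auto
  also have "(\<Sum>(i, j)\<in>?L \<union> ?G. f (Z i j \<omega>)) = (\<Sum>(i, j)\<in>?L. f (Z i j \<omega>)) + (\<Sum>(i, j)\<in>?G. f (Z i j \<omega>))"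
    using fin by (intro sum.union_disjoint) auto
  also have "(\<Sum>(i, j)\<in>?G. f (Z i j \<omega>)) = (\<Sum>(i, j)\<in>?L. f (Z i j \<omega>))"
    by (rule sum.reindex_bij_witness[of _ prod.swap prod.swap]) (auto intro!: arg_cong[where f = f] sym[symmetric])
  finally have s: "(\<Sum>i=1..n. \<Sum>j\<in>{1..n} - {i}. f (Z i j \<omega>)) = 2 * (\<Sum>(i, j)\<in>?L. f (Z i j \<omega>))" by simp
  have "(1 / real n) * (\<Sum>i=1..n. node_mean Z n f i \<omega>)
      = (1 / real n) * ((\<Sum>i=1..n. \<Sum>j\<in>{1..n} - {i}. f (Z i j \<omega>)) / (real n - 1))"
    unfolding node_mean_def by (simp only: sum_divide_distrib)
  also have "\<dots> = emp_mean Z n f \<omega>"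
    unfolding s emp_mean_def by simp
  finally show ?thesis .
qed

context dyadic_array
begin

lemma deviation_le_node_dev:
  assumes n: "2 \<le> n" and \<omega>: "\<omega> \<in> space M" and f: "f \<in> borel_measurable (obs_space \<X>)"
  shows "(1 / real n) * (\<Sum>i=1..n.
      (node_mean Z n f i \<omega> - emp_mean Z n f \<omega> - node_proj M U V \<tau> Z f (U i \<omega>)
        + (1 / real n) * (\<Sum>j=1..n. node_proj M U V \<tau> Z f (U j \<omega>)))\<^sup>2)
    \<le> 1 / (real n * (real n - 1)\<^sup>2) * (\<Sum>i=1..n. (node_dev n f i \<omega>)\<^sup>2)"
proof -
  define a where "a i = node_mean Z n f i \<omega> - cond_mean f (U i \<omega>)" for i
  have np: "node_proj M U V \<tau> Z f (U i \<omega>) = cond_mean f (U i \<omega>) - pop_mean M Z f"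
    if "i \<in> {1..n}" for i
    using that \<omega> by (intro node_proj_eq f measurable_space[OF U_measurable]) auto
  have em: "emp_mean Z n f \<omega> = (1 / real n) * (\<Sum>i=1..n. node_mean Z n f i \<omega>)"
    by (rule mean_node_mean_eq_emp_mean[symmetric, OF n]) (rule Z_flip[OF _ _ \<omega>])
  \<comment> \<open>\<open>pop_mean\<close> in this average cancels against the one in
    \<open>np\<close>, so the bracket involves only deviations from
    \<open>cond_mean\<close>.\<close>
  have mp: "(1 / real n) * (\<Sum>j=1..n. node_proj M U V \<tau> Z f (U j \<omega>))
      = (1 / real n) * (\<Sum>j=1..n. cond_mean f (U j \<omega>)) - pop_mean M Z f"
    using n by (simp add: np sum_subtractf right_diff_distrib)
  have "(\<Sum>i=1..n. (node_mean Z n f i \<omega> - emp_mean Z n f \<omega> - node_proj M U V \<tau> Z f (U i \<omega>)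
        + (1 / real n) * (\<Sum>j=1..n. node_proj M U V \<tau> Z f (U j \<omega>)))\<^sup>2)
      = (\<Sum>i=1..n. (a i - (1 / real n) * (\<Sum>j=1..n. a j))\<^sup>2)"
    unfolding mp em a_def sum_subtractf right_diff_distrib
    by (intro sum.cong refl arg_cong[where f = "\<lambda>x. x\<^sup>2"]) (simp add: np)
  also have "\<dots> \<le> (\<Sum>i=1..n. (a i)\<^sup>2)"
    using n by (intro sum_sq_centered_le) simp
  also have "\<dots> = (\<Sum>i=1..n. (node_dev n f i \<omega>)\<^sup>2 / (real n - 1)\<^sup>2)"
  proof (rule sum.cong[OF refl])
    fix i assume i: "i \<in> {1..n}"
    have "node_dev n f i \<omega> = (\<Sum>j\<in>{1..n} - {i}. f (Z i j \<omega>)) - (real n - 1) * cond_mean f (U i \<omega>)"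
      using i n by (simp add: node_dev_def sum_subtractf of_nat_diff)
    then have "a i = node_dev n f i \<omega> / (real n - 1)"
      using n by (simp add: a_def node_mean_def diff_divide_distrib)
    then show "(a i)\<^sup>2 = (node_dev n f i \<omega>)\<^sup>2 / (real n - 1)\<^sup>2" by (simp add: power_divide)
  qed
  also have "\<dots> = (\<Sum>i=1..n. (node_dev n f i \<omega>)\<^sup>2) / (real n - 1)\<^sup>2"
    by (simp only: sum_divide_distrib)
  finally show ?thesis
    using n by (simp add: field_simps)
qed

section \<open>From the countable subclass to the whole class\<close>

lemma Z_in_obs_space:
  assumes "1 \<le> i" "1 \<le> j" "i \<noteq> j" "\<omega> \<in> space M"
  shows "Z i j \<omega> \<in> space (obs_space \<X>)"
proof -
  have *: "Z k l \<omega> \<in> space (obs_space \<X>)" if "1 \<le> k" "k < l" for k l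
  proof -
    have "(U k \<omega>, U l \<omega>, V k l \<omega>) \<in> space (MU \<Otimes>\<^sub>M (MU \<Otimes>\<^sub>M MV))"
      using that assms U_measurable V_measurable
      by (auto simp: space_pair_measure intro!: measurable_space[where M = M])
    from measurable_space[OF tau_measurable this] show ?thesis
      using that assms by (simp add: Z_eq)
  qed
  show ?thesis
    using *[of i j] *[of j i] assms Z_flip[of j i \<omega>] by (cases "i < j") auto
qed

text \<open>The section of \<open>F\<close> is an integrable dominating function wherever its second
  moment is finite. This condition on \<open>u\<close> mentions only \<open>F\<close>, so the
  exceptional set is common to all limits \<open>f\<close>.\<close>

lemma cond_mean_limit:
  assumes u: "u \<in> space MU"
    and meas: "\<And>m. g m \<in> borel_measurable (obs_space \<X>)" "f \<in> borel_measurable (obs_space \<X>)"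
    and F: "F \<in> borel_measurable (obs_space \<X>)"
    and env: "\<And>m z. z \<in> space (obs_space \<X>) \<Longrightarrow> \<bar>g m z\<bar> \<le> F z"
    and lim: "\<And>z. z \<in> space (obs_space \<X>) \<Longrightarrow> (\<lambda>m. g m z) \<longlonglongrightarrow> f z"
    and fin: "(\<integral>\<^sup>+w. ennreal ((F (\<tau> u (fst w) (snd w)))\<^sup>2) \<partial>(DU \<Otimes>\<^sub>M DV)) < \<infinity>"
  shows "(\<lambda>m. cond_mean (g m) u) \<longlonglongrightarrow> cond_mean f u"
proof -
  interpret D: prob_space "DU \<Otimes>\<^sub>M DV" by (rule prob_space_DUV)
  note tm = tau_section_measurable[OF u]
  have Fm: "(\<lambda>w. F (\<tau> u (fst w) (snd w))) \<in> borel_measurable (DU \<Otimes>\<^sub>M DV)"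
    by (rule measurable_compose[OF tm F])
  have "integrable (DU \<Otimes>\<^sub>M DV) (\<lambda>w. (F (\<tau> u (fst w) (snd w)))\<^sup>2)"
    using Fm fin by (intro integrableI_nonneg borel_measurable_power) auto
  then have Fi: "integrable (DU \<Otimes>\<^sub>M DV) (\<lambda>w. F (\<tau> u (fst w) (snd w)))"
    by (rule D.integrable_of_square[OF Fm])
  show ?thesis
    unfolding cond_mean_def
  proof (rule integral_dominated_convergence[OF _ _ Fi])
    show "(\<lambda>w. f (\<tau> u (fst w) (snd w))) \<in> borel_measurable (DU \<Otimes>\<^sub>M DV)"
      by (rule measurable_compose[OF tm meas(2)])
    show "(\<lambda>w. g m (\<tau> u (fst w) (snd w))) \<in> borel_measurable (DU \<Otimes>\<^sub>M DV)" for m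
      by (rule measurable_compose[OF tm meas(1)])
    show "AE w in DU \<Otimes>\<^sub>M DV. (\<lambda>m. g m (\<tau> u (fst w) (snd w))) \<longlonglongrightarrow> f (\<tau> u (fst w) (snd w))"
      by (rule AE_I2) (rule lim[OF measurable_space[OF tm]])
    show "AE w in DU \<Otimes>\<^sub>M DV. norm (g m (\<tau> u (fst w) (snd w))) \<le> F (\<tau> u (fst w) (snd w))" for m
      by (rule AE_I2) (simp add: env[OF measurable_space[OF tm]])
  qed
qed

text \<open>The nodes having the same law, the section moment at each \<open>U i\<close> integrates
  to the second moment of \<open>F (Z 1 2 \<omega>)\<close>. Having a finite mean it is finite
  almost surely, and countably many nodes leave a single null set.\<close>

lemma AE_finite_section:
  assumes F: "F \<in> borel_measurable (obs_space \<X>)" and int: "integrable M (\<lambda>\<omega>. (F (Z 1 2 \<omega>))\<^sup>2)"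
  shows "AE \<omega> in M. \<forall>i\<ge>1. (\<integral>\<^sup>+w. ennreal ((F (\<tau> (U i \<omega>) (fst w) (snd w)))\<^sup>2) \<partial>(DU \<Otimes>\<^sub>M DV)) < \<infinity>"
proof -
  let ?D = "DU \<Otimes>\<^sub>M DV"
  interpret D: prob_space ?D by (rule prob_space_DUV)
  define \<phi> where "\<phi> u = (\<integral>\<^sup>+w. ennreal ((F (\<tau> u (fst w) (snd w)))\<^sup>2) \<partial>?D)" for u
  have m: "(\<lambda>(u, w). ennreal ((F (\<tau> u (fst w) (snd w)))\<^sup>2)) \<in> borel_measurable (MU \<Otimes>\<^sub>M ?D)"
  proof -
    have "(\<lambda>(u, w). F (\<tau> u (fst w) (snd w))) \<in> borel_measurable (MU \<Otimes>\<^sub>M ?D)"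
      using measurable_compose[OF tau_joint_measurable F]
      by (simp add: case_prod_beta' measurable_cong_sets[OF sets_pair_measure_cong[OF refl sets_DUV] refl])
    then show ?thesis by (simp add: case_prod_beta')
  qed
  have \<phi>m: "\<phi> \<in> borel_measurable MU"
    unfolding \<phi>_def[abs_def] using D.borel_measurable_nn_integral[OF m] .
  have "(\<integral>\<^sup>+y. \<phi> (fst y) \<partial>?D) = (\<integral>\<^sup>+\<omega>. ennreal ((F (Z 1 2 \<omega>))\<^sup>2) \<partial>M)"
    unfolding \<phi>_def using F by (intro nn_integral_dyad[symmetric]) measurable
  also have "\<dots> < \<infinity>" using int by (simp add: integrable_iff_bounded)
  finally have fin: "(\<integral>\<^sup>+y. \<phi> (fst y) \<partial>?D) \<noteq> \<infinity>" by simp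
  have "AE \<omega> in M. \<phi> (U i \<omega>) < \<infinity>" if i: "1 \<le> i" for i
  proof -
    have d: "distr M (MU \<Otimes>\<^sub>M MV) (\<lambda>\<omega>. (U i \<omega>, V 1 2 \<omega>)) = ?D"
      by (rule distr_node_dyad[OF i]) auto
    have pm: "(\<lambda>\<omega>. (U i \<omega>, V 1 2 \<omega>)) \<in> M \<rightarrow>\<^sub>M MU \<Otimes>\<^sub>M MV" by (rule pair_measurable[OF i]) auto
    have fm: "(\<lambda>y. \<phi> (fst y)) \<in> borel_measurable (MU \<Otimes>\<^sub>M MV)"
      by (rule measurable_compose[OF measurable_fst \<phi>m])
    have "(\<integral>\<^sup>+\<omega>. \<phi> (U i \<omega>) \<partial>M) = (\<integral>\<^sup>+y. \<phi> (fst y) \<partial>?D)"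
      unfolding d[symmetric] using fm by (simp add: nn_integral_distr[OF pm] del: One_nat_def)
    with fin have "(\<integral>\<^sup>+\<omega>. \<phi> (U i \<omega>) \<partial>M) \<noteq> \<infinity>" by simp
    from nn_integral_PInf_AE[OF measurable_compose[OF U_measurable[OF i] \<phi>m] this]
    show ?thesis by (simp add: less_top)
  qed
  then have "AE \<omega> in M. 1 \<le> i \<longrightarrow> \<phi> (U i \<omega>) < \<infinity>" for i
    by (cases "1 \<le> i") auto
  then have "AE \<omega> in M. \<forall>i. 1 \<le> i \<longrightarrow> \<phi> (U i \<omega>) < \<infinity>"
    by (simp add: AE_all_countable)
  then show ?thesis by (simp only: \<phi>_def)
qed

text \<open>The majorant \<open>S\<close>, a supremum over the countable subclass, is measurable and
  dominates the full supremum off a null set. The exceedance event thus lies in a measurable set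
  plus a null set, where outer measure is ordinary measure, and Markov's inequality applies.\<close>

lemma outer_measure_deviation_le:
  assumes meas: "\<And>f. f \<in> \<F> \<Longrightarrow> f \<in> borel_measurable (obs_space \<X>)"
    and pm: "pointwise_measurable (obs_space \<X>) \<F>"
    and F: "F \<in> borel_measurable (obs_space \<X>)"
    and env: "\<And>f z. f \<in> \<F> \<Longrightarrow> z \<in> space (obs_space \<X>) \<Longrightarrow> \<bar>f z\<bar> \<le> F z"
    and cover: "\<And>(J :: nat set) z. finite J \<Longrightarrow> z \<in> J \<rightarrow> space (obs_space \<X>) \<Longrightarrow>
      \<exists>G::(real \<times> (real ^ 'd) \<Rightarrow> real) set. finite G \<and> card G \<le> N \<and>
        (\<forall>f\<in>\<F>. \<exists>g\<in>G. (\<Sum>j\<in>J. (f (z j) - g (z j))\<^sup>2) \<le> \<delta>\<^sup>2 * (\<Sum>j\<in>J. (F (z j))\<^sup>2))"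
    and int: "integrable M (\<lambda>\<omega>. (F (Z 1 2 \<omega>))\<^sup>2)"
    and \<delta>: "0 < \<delta>" "\<delta> \<le> 1" and n: "2 \<le> n" and \<epsilon>: "0 < \<epsilon>"
  shows "outer_measure_of M {\<omega> \<in> space M. (SUP f\<in>\<F>. ennreal
           ((1 / real n) * (\<Sum>i=1..n.
              (node_mean Z n f i \<omega> - emp_mean Z n f \<omega> - node_proj M U V \<tau> Z f (U i \<omega>)
                + (1 / real n) * (\<Sum>j=1..n. node_proj M U V \<tau> Z f (U j \<omega>)))\<^sup>2))) > ennreal \<epsilon>}
    \<le> ennreal ((8 * \<delta>\<^sup>2 + 32 * real N / (real n - 1)) * expectation (\<lambda>\<omega>. (F (Z 1 2 \<omega>))\<^sup>2) / \<epsilon>)"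
proof -
  define X where "X f \<omega> = (1 / real n) * (\<Sum>i=1..n.
              (node_mean Z n f i \<omega> - emp_mean Z n f \<omega> - node_proj M U V \<tau> Z f (U i \<omega>)
                + (1 / real n) * (\<Sum>j=1..n. node_proj M U V \<tau> Z f (U j \<omega>)))\<^sup>2)" for f \<omega>
  define r where "r = 1 / (real n * (real n - 1)\<^sup>2)"
  define A where "A f \<omega> = r * (\<Sum>i=1..n. (node_dev n f i \<omega>)\<^sup>2)" for f \<omega>
  define E where "E = expectation (\<lambda>\<omega>. (F (Z 1 2 \<omega>))\<^sup>2)"
  have E0: "0 \<le> E" by (simp add: E_def)
  have r0: "0 \<le> r" by (simp add: r_def)
  obtain \<G> where \<G>: "\<G> \<subseteq> \<F>" "countable \<G>"
    and dense: "\<And>f. f \<in> \<F> \<Longrightarrow> \<exists>g. (\<forall>m. g m \<in> \<G>) \<and> (\<forall>z\<in>space (obs_space \<X>). (\<lambda>m. g m z) \<longlonglongrightarrow> f z)"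
    using pm unfolding pointwise_measurable_def by blast
  define S where "S \<omega> = (SUP f\<in>\<G>. ennreal (A f \<omega>))" for \<omega>
  have Sm: "S \<in> borel_measurable M"
    unfolding S_def[abs_def] A_def using \<G>
    by (intro borel_measurable_SUP measurable_compose[OF _ measurable_ennreal]
        borel_measurable_times borel_measurable_const borel_measurable_sum
        borel_measurable_power node_dev_measurable meas) auto
  have S_int: "(\<integral>\<^sup>+\<omega>. S \<omega> \<partial>M) \<le> ennreal ((8 * \<delta>\<^sup>2 + 32 * real N / (real n - 1)) * E)"
  proof -
    define C where "C = 4 * (2 * (real n - 1) * \<delta>\<^sup>2 + 8 * real N) * (real n - 1)"
    have C0: "0 \<le> C" using n by (simp add: C_def)
    let ?T = "\<lambda>i \<omega>. SUP f\<in>\<G>. ennreal ((node_dev n f i \<omega>)\<^sup>2)"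
    have Tm: "?T i \<in> borel_measurable M" if "i \<in> {1..n}" for i
      using \<G> that by (intro borel_measurable_SUP measurable_compose[OF _ measurable_ennreal]
        borel_measurable_power node_dev_measurable meas) auto
    have T: "(\<integral>\<^sup>+\<omega>. ?T i \<omega> \<partial>M) \<le> ennreal (C * E)" if i: "i \<in> {1..n}" for i
    proof -
      have "(\<integral>\<^sup>+\<omega>. ?T i \<omega> \<partial>M) \<le> ennreal C * (\<integral>\<^sup>+\<omega>. ennreal ((F (Z 1 2 \<omega>))\<^sup>2) \<partial>M)"
        unfolding C_def
      proof (rule nn_integral_SUP_node_dev_le[OF \<G>(2) _ F _ _ \<delta> i n])
        show "f \<in> borel_measurable (obs_space \<X>)" if "f \<in> \<G>" for f
          using that \<G>(1) meas by blast
        show "\<bar>f z\<bar> \<le> F z" if "f \<in> \<G>" "z \<in> space (obs_space \<X>)" for f z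
          using that \<G>(1) env by blast
        fix J :: "nat set" and z assume "finite J" "z \<in> J \<rightarrow> space (obs_space \<X>)"
        from cover[OF this] show "\<exists>G::(real \<times> (real ^ 'd) \<Rightarrow> real) set. finite G \<and> card G \<le> N \<and>
          (\<forall>f\<in>\<G>. \<exists>g\<in>G. (\<Sum>j\<in>J. (f (z j) - g (z j))\<^sup>2) \<le> \<delta>\<^sup>2 * (\<Sum>j\<in>J. (F (z j))\<^sup>2))"
          using \<G>(1) by (meson subsetD)
      qed
      also have "\<dots> = ennreal (C * E)"
        unfolding E_def using C0 by (subst nn_integral_eq_integral[OF int]) (simp_all add: ennreal_mult')
      finally show ?thesis .
    qed
    have "(\<integral>\<^sup>+\<omega>. S \<omega> \<partial>M) \<le> (\<integral>\<^sup>+\<omega>. ennreal r * (\<Sum>i=1..n. ?T i \<omega>) \<partial>M)"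
    proof (rule nn_integral_mono)
      fix \<omega>
      show "S \<omega> \<le> ennreal r * (\<Sum>i=1..n. ?T i \<omega>)"
        unfolding S_def
      proof (rule SUP_least)
        fix f assume f: "f \<in> \<G>"
        have "ennreal (A f \<omega>) = ennreal r * (\<Sum>i=1..n. ennreal ((node_dev n f i \<omega>)\<^sup>2))"
          unfolding A_def using r0 by (simp add: ennreal_mult' sum_nonneg)
        also have "\<dots> \<le> ennreal r * (\<Sum>i=1..n. ?T i \<omega>)"
          using f by (intro mult_left_mono sum_mono SUP_upper) auto
        finally show "ennreal (A f \<omega>) \<le> ennreal r * (\<Sum>i=1..n. ?T i \<omega>)" .
      qed
    qed
    also have "\<dots> = ennreal r * (\<integral>\<^sup>+\<omega>. (\<Sum>i=1..n. ?T i \<omega>) \<partial>M)"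
      by (rule nn_integral_cmult) (rule borel_measurable_sum[OF Tm])
    also have "(\<integral>\<^sup>+\<omega>. (\<Sum>i=1..n. ?T i \<omega>) \<partial>M) = (\<Sum>i=1..n. \<integral>\<^sup>+\<omega>. ?T i \<omega> \<partial>M)"
      by (rule nn_integral_sum) (rule Tm)
    also have "ennreal r * \<dots> \<le> ennreal r * (\<Sum>i=1..n. ennreal (C * E))"
      by (intro mult_left_mono sum_mono T) auto
    also have "\<dots> = ennreal (r * (real n * (C * E)))"
      using r0 C0 E0 by (simp add: ennreal_of_nat_eq_real_of_nat ennreal_mult' del: sum_ennreal)
    \<comment> \<open>The sum over \<open>n\<close> nodes cancels the \<open>1 / n\<close> in
      \<open>r\<close>, and the factor \<open>n - 1\<close> in \<open>C\<close> cancels one of the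
      two in the normalization.\<close>
    also have "r * (real n * (C * E)) = (8 * \<delta>\<^sup>2 + 32 * real N / (real n - 1)) * E"
    proof -
      define m where "m = real n - 1"
      have "m > 0" using n by (simp add: m_def)
      then show ?thesis
        using n unfolding r_def C_def m_def[symmetric] by (simp add: field_simps power2_eq_square)
    qed
    finally show ?thesis .
  qed
  obtain Nul where Nul: "Nul \<in> null_sets M" and good: "\<And>\<omega>. \<omega> \<in> space M - Nul \<Longrightarrow>
      \<forall>i\<ge>1. (\<integral>\<^sup>+w. ennreal ((F (\<tau> (U i \<omega>) (fst w) (snd w)))\<^sup>2) \<partial>(DU \<Otimes>\<^sub>M DV)) < \<infinity>"
    using AE_E3[OF AE_finite_section[OF F int]] by blast
  \<comment> \<open>The limit is taken in the majorant \<open>A\<close>, which is continuous in the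
    finitely many values \<open>f (Z i j \<omega>)\<close> and
    \<open>cond_mean f (U i \<omega>)\<close>; the statistic \<open>X\<close> is compared with
    \<open>A\<close> only at the limit \<open>f\<close>.\<close>
  have le_S: "ennreal (X f \<omega>) \<le> S \<omega>" if \<omega>: "\<omega> \<in> space M - Nul" and f: "f \<in> \<F>" for f \<omega>
  proof -
    obtain g where g: "\<And>m. g m \<in> \<G>" "\<And>z. z \<in> space (obs_space \<X>) \<Longrightarrow> (\<lambda>m. g m z) \<longlonglongrightarrow> f z"
      using dense[OF f] by blast
    have gF: "g m \<in> \<F>" for m using g(1) \<G>(1) by blast
    have "(\<lambda>m. node_dev n (g m) i \<omega>) \<longlonglongrightarrow> node_dev n f i \<omega>" if i: "i \<in> {1..n}" for i
      unfolding node_dev_def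
    proof (intro tendsto_sum tendsto_diff)
      show "(\<lambda>m. g m (Z i j \<omega>)) \<longlonglongrightarrow> f (Z i j \<omega>)" if "j \<in> {1..n} - {i}" for j
        using that i \<omega> by (intro g(2) Z_in_obs_space) auto
      have "U i \<omega> \<in> space MU"
        using i \<omega> by (intro measurable_space[OF U_measurable]) auto
      then show "(\<lambda>m. cond_mean (g m) (U i \<omega>)) \<longlonglongrightarrow> cond_mean f (U i \<omega>)"
        using good[OF \<omega>] i by (intro cond_mean_limit[OF _ meas[OF gF] meas[OF f] F env[OF gF] g(2)]) auto
    qed
    then have "(\<lambda>m. A (g m) \<omega>) \<longlonglongrightarrow> A f \<omega>"
      unfolding A_def by (intro tendsto_mult tendsto_const tendsto_sum tendsto_power)
    then have "(\<lambda>m. ennreal (A (g m) \<omega>)) \<longlonglongrightarrow> ennreal (A f \<omega>)"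
      by (rule tendsto_ennrealI)
    then have "ennreal (A f \<omega>) \<le> S \<omega>"
      by (rule LIMSEQ_le_const2) (auto simp: S_def intro!: SUP_upper g(1))
    moreover have "X f \<omega> \<le> A f \<omega>"
      unfolding X_def A_def r_def using \<omega> by (intro deviation_le_node_dev[OF n _ meas[OF f]]) auto
    ultimately show ?thesis by (meson ennreal_leI order_trans)
  qed
  let ?B = "{\<omega> \<in> space M. 1 \<le> ennreal (1 / \<epsilon>) * S \<omega>}"
  have Bm: "?B \<in> sets M" using Sm by measurable
  have "{\<omega> \<in> space M. (SUP f\<in>\<F>. ennreal (X f \<omega>)) > ennreal \<epsilon>} \<subseteq> ?B \<union> Nul"
  proof
    fix \<omega> assume \<omega>: "\<omega> \<in> {\<omega> \<in> space M. (SUP f\<in>\<F>. ennreal (X f \<omega>)) > ennreal \<epsilon>}"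
    show "\<omega> \<in> ?B \<union> Nul"
    proof (cases "\<omega> \<in> Nul")
      case False
      then have "(SUP f\<in>\<F>. ennreal (X f \<omega>)) \<le> S \<omega>" using \<omega> by (intro SUP_least le_S) auto
      then have "ennreal \<epsilon> \<le> S \<omega>" using \<omega> by auto
      then have "ennreal (1 / \<epsilon>) * ennreal \<epsilon> \<le> ennreal (1 / \<epsilon>) * S \<omega>"
        by (rule mult_left_mono) simp
      moreover have "ennreal (1 / \<epsilon>) * ennreal \<epsilon> = 1"
        using \<epsilon> by (simp add: ennreal_mult'[symmetric])
      ultimately show ?thesis using \<omega> by simp
    qed simp
  qed
  then have "outer_measure_of M {\<omega> \<in> space M. (SUP f\<in>\<F>. ennreal (X f \<omega>)) > ennreal \<epsilon>}
      \<le> outer_measure_of M (?B \<union> Nul)"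
    by (rule outer_measure_of_mono)
  also have "\<dots> = emeasure M ?B"
    by (simp only: outer_measure_of_eq[OF sets.Un[OF Bm null_setsD2[OF Nul]]]
        emeasure_Un_null_set[OF Bm Nul])
  also have "\<dots> \<le> ennreal (1 / \<epsilon>) * (\<integral>\<^sup>+\<omega>. S \<omega> * indicator (space M) \<omega> \<partial>M)"
    using Sm by (intro nn_integral_Markov_inequality) auto
  also have "(\<integral>\<^sup>+\<omega>. S \<omega> * indicator (space M) \<omega> \<partial>M) = (\<integral>\<^sup>+\<omega>. S \<omega> \<partial>M)"
    by (intro nn_integral_cong) simp
  also have "ennreal (1 / \<epsilon>) * (\<integral>\<^sup>+\<omega>. S \<omega> \<partial>M)
      \<le> ennreal (1 / \<epsilon>) * ennreal ((8 * \<delta>\<^sup>2 + 32 * real N / (real n - 1)) * E)"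
    by (rule mult_left_mono[OF S_int]) simp
  also have "\<dots> = ennreal ((8 * \<delta>\<^sup>2 + 32 * real N / (real n - 1)) * E / \<epsilon>)"
    using \<epsilon> by (simp add: ennreal_mult'[symmetric])
  finally show ?thesis by (simp only: X_def E_def)
qed

end

section \<open>Choice of the radius and the limit in n\<close>

theorem lemma9:
  fixes M :: "'w measure" and MU :: "'u measure" and MV :: "'v measure"
    and U :: "nat \<Rightarrow> 'w \<Rightarrow> 'u" and V :: "nat \<Rightarrow> nat \<Rightarrow> 'w \<Rightarrow> 'v"
    and \<tau> :: "'u \<Rightarrow> 'u \<Rightarrow> 'v \<Rightarrow> real \<times> (real ^ 'd)" and \<X> :: "(real ^ 'd) set"
    and Z :: "nat \<Rightarrow> nat \<Rightarrow> 'w \<Rightarrow> real \<times> (real ^ 'd)"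
    and \<F> :: "(real \<times> (real ^ 'd) \<Rightarrow> real) set" and F :: "real \<times> (real ^ 'd) \<Rightarrow> real"
  assumes "dyadic_array M MU MV U V \<tau> \<X> Z"
    and "\<forall>f\<in>\<F>. f \<in> borel_measurable (obs_space \<X>)"
    and "pointwise_measurable (obs_space \<X>) \<F>"
    and "vc_type (obs_space \<X>) \<F> F"
    and "integrable M (\<lambda>\<omega>. (F (Z 1 2 \<omega>))\<^sup>2)"
  shows "o_p_1 M (\<lambda>n \<omega>. SUP f\<in>\<F>. ennreal
           ((1 / real n) * (\<Sum>i=1..n.
              (node_mean Z n f i \<omega> - emp_mean Z n f \<omega> - node_proj M U V \<tau> Z f (U i \<omega>)
                + (1 / real n) * (\<Sum>j=1..n. node_proj M U V \<tau> Z f (U j \<omega>)))\<^sup>2)))"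
  unfolding o_p_1_def
proof (intro allI impI)
  fix \<epsilon> :: real assume \<epsilon>: "0 < \<epsilon>"
  interpret dyadic_array M MU MV U V \<tau> \<X> Z by fact
  define E where "E = expectation (\<lambda>\<omega>. (F (Z 1 2 \<omega>))\<^sup>2)"
  have E0: "0 \<le> E" by (simp add: E_def)
  define p where "p n = outer_measure_of M {\<omega> \<in> space M. (SUP f\<in>\<F>. ennreal
           ((1 / real n) * (\<Sum>i=1..n.
              (node_mean Z n f i \<omega> - emp_mean Z n f \<omega> - node_proj M U V \<tau> Z f (U i \<omega>)
                + (1 / real n) * (\<Sum>j=1..n. node_proj M U V \<tau> Z f (U j \<omega>)))\<^sup>2))) > ennreal \<epsilon>}" for n
  have F: "F \<in> borel_measurable (obs_space \<X>)"
    and env: "\<And>f z. f \<in> \<F> \<Longrightarrow> z \<in> space (obs_space \<X>) \<Longrightarrow> \<bar>f z\<bar> \<le> F z"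
    using assms(4) by (auto simp: vc_type_def)
  have ev: "eventually (\<lambda>n. p n < ennreal \<eta>) sequentially" if \<eta>: "0 < \<eta>" for \<eta> :: real
  proof -
    \<comment> \<open>Since \<delta> \<le> 1, \<open>8 * \<delta>\<^sup>2 * E\<close> is at most
      \<open>8 * \<delta> * (E + 1)\<close>, and the 16 makes this at most half of
      \<open>\<eta> * \<epsilon>\<close>. Using \<open>E + 1\<close> avoids division by zero when
      \<open>E = 0\<close>.\<close>
    define \<delta> where "\<delta> = min 1 (\<eta> * \<epsilon> / (16 * (E + 1)))"
    have \<delta>: "0 < \<delta>" "\<delta> \<le> 1" using \<eta> \<epsilon> E0 by (simp_all add: \<delta>_def)
    have "8 * \<delta>\<^sup>2 * E \<le> 8 * \<delta> * (E + 1)"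
      using \<delta> E0 by (intro mult_mono) (simp_all add: power2_eq_square)
    also have "\<dots> \<le> 8 * (\<eta> * \<epsilon> / (16 * (E + 1))) * (E + 1)"
      using E0 by (intro mult_right_mono mult_left_mono) (simp_all add: \<delta>_def)
    also have "\<dots> = \<eta> * \<epsilon> / 2" using E0 by (simp add: field_simps)
    also have "\<dots> < \<eta> * \<epsilon>" using \<eta> \<epsilon> by simp
    finally have small: "8 * \<delta>\<^sup>2 * E / \<epsilon> < \<eta>" using \<epsilon> by (simp add: field_simps)
    \<comment> \<open>\<open>N\<close> is fixed together with \<delta>, before \<open>n\<close>
      varies, so its term vanishes in the limit.\<close>
    obtain N :: nat where N: "\<And>(J :: nat set) z. finite J \<Longrightarrow> z \<in> J \<rightarrow> space (obs_space \<X>) \<Longrightarrow>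
      \<exists>G::(real \<times> (real ^ 'd) \<Rightarrow> real) set. finite G \<and> card G \<le> N \<and>
        (\<forall>f\<in>\<F>. \<exists>g\<in>G. (\<Sum>j\<in>J. (f (z j) - g (z j))\<^sup>2) \<le> \<delta>\<^sup>2 * (\<Sum>j\<in>J. (F (z j))\<^sup>2))"
      using vc_type_empirical_cover[OF assms(4) \<delta>] by blast
    have "(\<lambda>n. 32 * real N / (real n - 1)) \<longlonglongrightarrow> 0"
      by real_asymp
    then have "(\<lambda>n. (8 * \<delta>\<^sup>2 + 32 * real N / (real n - 1)) * E / \<epsilon>) \<longlonglongrightarrow> (8 * \<delta>\<^sup>2 + 0) * E / \<epsilon>"
      using \<epsilon> by (intro tendsto_intros) auto
    then have "eventually (\<lambda>n. (8 * \<delta>\<^sup>2 + 32 * real N / (real n - 1)) * E / \<epsilon> < \<eta>) sequentially"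
      using small by (intro order_tendstoD) auto
    then show ?thesis
      using eventually_ge_at_top[of "2::nat"]
    proof eventually_elim
      case (elim n)
      have "p n \<le> ennreal ((8 * \<delta>\<^sup>2 + 32 * real N / (real n - 1)) * E / \<epsilon>)"
        unfolding p_def E_def
      proof (rule outer_measure_deviation_le[where N = N])
        show "\<bar>f z\<bar> \<le> F z" if "f \<in> \<F>" "z \<in> space (obs_space \<X>)" for f z
          using that by (rule env)
        show "\<exists>G::(real \<times> (real ^ 'd) \<Rightarrow> real) set. finite G \<and> card G \<le> N \<and>
            (\<forall>f\<in>\<F>. \<exists>g\<in>G. (\<Sum>j\<in>J. (f (z j) - g (z j))\<^sup>2) \<le> \<delta>\<^sup>2 * (\<Sum>j\<in>J. (F (z j))\<^sup>2))"
          if "finite J" "z \<in> J \<rightarrow> space (obs_space \<X>)" for J :: "nat set" and z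
          using that by (rule N)
      qed (use assms(2,3,5) F \<delta> \<epsilon> elim(2) in auto)
      also have "\<dots> < ennreal \<eta>" using elim(1) \<eta> by (simp add: ennreal_lessI)
      finally show ?case .
    qed
  qed
  have "p \<longlonglongrightarrow> 0"
  proof (rule order_tendstoI)
    fix a :: ennreal assume a: "0 < a"
    show "eventually (\<lambda>n. p n < a) sequentially"
    proof -
      \<comment> \<open>\<open>a\<close> may be infinite; an intermediate \<open>b\<close> is finite
        and positive, hence of the form \<open>ennreal \<eta>\<close>.\<close>
      obtain b where b: "0 < b" "b < a" using dense[OF a] by blast
      then obtain \<eta> where "b = ennreal \<eta>" "0 < \<eta>" by (cases b) auto
      with ev[of \<eta>] b show ?thesis by (auto elim: eventually_mono)
    qed
  qed simp
  then show "(\<lambda>n. outer_measure_of M {\<omega> \<in> space M. (SUP f\<in>\<F>. ennreal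
           ((1 / real n) * (\<Sum>i=1..n.
              (node_mean Z n f i \<omega> - emp_mean Z n f \<omega> - node_proj M U V \<tau> Z f (U i \<omega>)
                + (1 / real n) * (\<Sum>j=1..n. node_proj M U V \<tau> Z f (U j \<omega>)))\<^sup>2))) > ennreal \<epsilon>}) \<longlonglongrightarrow> 0"
    by (simp only: p_def[abs_def])
qed

end
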